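(* Let $\vec X=(X_0,X_1)$ be an interpolation couple of compatible Banach lattices, and let $X$ be an intermediate space of $\vec X$. Consider the following assertions: (i) The space $X$ is an exact partially $K$-monotone space. (ii) The space $X$ is an exact interpolation space for positive Gagliardo-Peetre operators on $\vec X$, in the sense that for every positive Gagliardo-Peetre operator $S$ from $\vec X$ into $\vec X$ and every $f\in X\cap D_S$ one has $Sf\in X$ and $\|Sf\|_X\le\|S\|_{GP^+}\,\|f\|_X$. (iii) The space $X$ is an exact interpolation space for order preserving Lipschitz operators on $\vec X$ for which the domain is a solid lattice, that is, for every admissible, order preserving Lipschitz operator $S$ from $\vec X$ into $\vec X$ such that $D_S$ is a solid lattice, and for every $f,\hat f\in D_S$ one has $\|Sf-S\hat f\|_X\le\|S\|_{Lip}\|f-\hat f\|_X$. (iv) The space $X$ is an exact interpolation space for positive, linear operators on $\vec X$. Then (i)$\Leftrightarrow$(ii)$\Rightarrow$(iii)$\Rightarrow$(iv). Moreover, if $\vec X$ is an exact Calderón-Mityagin couple with respect to positive operators, if both $X_0$ and $X_1$ are $\sigma$-Dedekind complete, and if for every pair of principal band projections $P,Q\in\mathcal L^+(\vec X)$ and every pair of contractions $T_1\in\mathcal L^+(P\vec X,Q\vec X)$, $T_2\in\mathcal L^+((I-P)\vec X,(I-Q)\vec X)$ the diagonal operator $T=QT_1P+(I-Q)T_2(I-P)\in\mathcal L(\vec X)$ is a contraction, then all four assertions are equivalent.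
   Context: Banach lattices are real. An interpolation couple $\vec X=(X_0,X_1)$ of Banach spaces is a pair of Banach spaces continuously embedded in a common Hausdorff topological vector space; $\|f\|_{X_0\cap X_1}=\|f\|_{X_0}+\|f\|_{X_1}$ and $\|f\|_{X_0+X_1}=\inf\{\|f_0\|_{X_0}+\|f_1\|_{X_1}:f_i\in X_i,\ f=f_0+f_1\}$. It is an interpolation couple of compatible Banach lattices if $X_0$, $X_1$ and $X_0+X_1$ are Banach lattices and $X_0$, $X_1$ are order ideals in $X_0+X_1$. An intermediate space is a Banach space $X$ with $X_0\cap X_1\subseteq X\subseteq X_0+X_1$ with continuous embeddings. Write $f^+=f\vee0$, $f^-=(-f)\vee0$. $K(f,t)=\inf\{\|f_0\|_{X_0}+t\|f_1\|_{X_1}: f=f_0+f_1,\ f_i\in X_i\}$ for $f\in X_0+X_1$, $t\in(0,\infty)$. Write $g\ll_K f$ if $K(g^+,\cdot)\le K(f^+,\cdot)$ and $K(g^-,\cdot)\le K(f^-,\cdot)$ pointwise on $(0,\infty)$. $X$ is exactly partially $K$-monotone if for every $f\in X$, $g\in X_0+X_1$: $g\ll_K f$ implies $g\in X$ and $\|g\|_X\le\|f\|_X$. A (possibly nonlinear) operator $S:X_0+X_1\supseteq D_S\to X_0+X_1$ with nonempty domain is a positive Gagliardo-Peetre operator if there is $C\ge0$ such that for all $f\in D_S$, all $f_i\in X_i$ with $f=f_0+f_1$ and all $\varepsilon>0$ there exist $g_i\in X_i$ with $Sf=g_0+g_1$ and $\|g_i^\pm\|_{X_i}\le C\|f_i^\pm\|_{X_i}+\varepsilon$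 ($i=0,1$, both signs). The least such $C$ is $\|S\|_{GP^+}$. An operator $S:X_0+X_1\supseteq D_S\to X_0+X_1$ (nonempty domain) is an admissible Lipschitz operator if there is $C\ge0$ with $\|Sf-S\hat f\|_{X_i}\le C\|f-\hat f\|_{X_i}$ for all $f,\hat f\in D_S$, $i\in\{0,1\}$; the right-hand side is interpreted as $\infty$ if $f-\hat f\notin X_i$, and finiteness of the left-hand side means $Sf-S\hat f\in X_i$. The same convention is used for the inequality in $X$ in (iii). The least such $C$ is $\|S\|_{Lip}$. $S$ is order preserving if $Sg\le Sf$ whenever $g\le f$. A subset $A$ of an ordered Banach space $Z$ is solid if $g\le h\le f$ with $f,g\in A$, $h\in Z$ implies $h\in A$; a solid lattice is a solid subset of $X_0+X_1$ closed under $\vee$ and $\wedge$ (not necessarily linear). For couples $\vec X,\vec Y$, $\mathcal L(\vec X,\vec Y)$ is the space of linear $S:X_0+X_1\to Y_0+Y_1$ with $SX_i\subseteq Y_i$ and $S:X_i\to Y_i$ bounded ($i=0,1$), normed by $\|S\|_{\mathcal L(\vec X,\vec Y)}=\max_i\|S\|_{\mathcal L(X_i,Y_i)}$; $\mathcal L^+(\vec X,\vec Y)$ is the cone of positive operators in it; $\mathcal L(\vec X)=\mathcal L(\vec X,\vec X)$, $\mathcal L^+(\vec X)=\mathcal L^+(\vec X,\vec X)$. A contraction is an element of norm $\le1$. $X$ is an exact interpolation space for positive, linear operators if every $S\in\mathcal L^+(\vec X)$ satisfies $SX\subseteq X$ and $\|S\|_{\mathcal L(X)}\le\|S\|_{\mathcal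 L(\vec X)}$. $\vec X$ is an exact Calderón-Mityagin couple with respect to positive operators if for all positive $f,g\in X_0+X_1$ with $K(g,\cdot)\le K(f,\cdot)$ there is $T\in\mathcal L^+(\vec X)$ with $\|T\|_{\mathcal L(\vec X)}\le1$ and $Tf=g$. A Banach lattice is $\sigma$-Dedekind complete if every nonempty countable subset bounded from above has a supremum. A principal band projection is the canonical (band) projection of $X_0+X_1$ onto a band generated by a single element; $P\vec X=(PX_0,PX_1)$, and similarly for $Q$, $I-P$, $I-Q$. *)

theory Defs
  imports "HOL-Analysis.Analysis" "HOL-Algebra.Lattice"
begin

section \<open>Interpolation couples\<close>

text \<open>Hausdorff topological vector spaces over the reals.\<close>

class hausdorff_tvs = real_vector + topological_ab_group_add + t2_space +
  assumes tendsto_scaleR_nhds: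
    "filterlim (\<lambda>p. fst p *\<^sub>R snd p) (nhds (c *\<^sub>R x)) (nhds c \<times>\<^sub>F nhds x)"

instance real_normed_vector \<subseteq> hausdorff_tvs
proof
  fix c :: real and x :: 'a
  have "((\<lambda>p. fst p *\<^sub>R snd p) \<longlongrightarrow> c *\<^sub>R x) (nhds c \<times>\<^sub>F nhds x)"
    by (intro tendsto_scaleR filterlim_fst filterlim_snd)
  then show "filterlim (\<lambda>p. fst p *\<^sub>R snd p) (nhds (c *\<^sub>R x)) (nhds c \<times>\<^sub>F nhds x)" .
qed

text \<open>All spaces are subsets of one ambient vector space, each with its own norm. A norm, an order
  or an operator is a total function on the ambient type whose values outside the relevant subset
  are never used.\<close>

record 'a nspace =
  pts :: "'a set"
  nrm :: "'a \<Rightarrow> real"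

definition banach_space :: "'a::real_vector nspace \<Rightarrow> bool" where
  "banach_space Z \<longleftrightarrow>
     subspace (pts Z) \<and>
     (\<forall>x\<in>pts Z. 0 \<le> nrm Z x) \<and>
     (\<forall>x\<in>pts Z. nrm Z x = 0 \<longleftrightarrow> x = 0) \<and>
     (\<forall>x\<in>pts Z. \<forall>c. nrm Z (c *\<^sub>R x) = \<bar>c\<bar> * nrm Z x) \<and>
     (\<forall>x\<in>pts Z. \<forall>y\<in>pts Z. nrm Z (x + y) \<le> nrm Z x + nrm Z y) \<and>
     (\<forall>s::nat \<Rightarrow> 'a.
        (\<forall>k. s k \<in> pts Z) \<and> (\<forall>e>0. \<exists>N. \<forall>m\<ge>N. \<forall>n\<ge>N. nrm Z (s m - s n) < e)
        \<longrightarrow> (\<exists>x\<in>pts Z. (\<lambda>k. nrm Z (s k - x)) \<longlonglongrightarrow> 0))"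

definition continuously_embedded :: "'a::hausdorff_tvs nspace \<Rightarrow> bool" where
  "continuously_embedded Z \<longleftrightarrow>
     (\<forall>x\<in>pts Z. \<forall>U. open U \<and> x \<in> U \<longrightarrow>
        (\<exists>d>0. \<forall>y\<in>pts Z. nrm Z (y - x) < d \<longrightarrow> y \<in> U))"

text \<open>The order relation \<open>leq\<close> is that of the sum \<open>X\<^sub>0 + X\<^sub>1\<close>; the other spaces carry its
  restriction.\<close>

record 'a couple =
  sp0 :: "'a nspace"
  sp1 :: "'a nspace"
  leq :: "'a \<Rightarrow> 'a \<Rightarrow> bool"

definition int_space :: "'a::real_vector couple \<Rightarrow> 'a nspace" where
  "int_space X = \<lparr>pts = pts (sp0 X) \<inter> pts (sp1 X), nrm = (\<lambda>f. nrm (sp0 X) f + nrm (sp1 X) f)\<rparr>"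

definition sum_space :: "'a::real_vector couple \<Rightarrow> 'a nspace" where
  "sum_space X =
     \<lparr>pts = {f0 + f1 | f0 f1. f0 \<in> pts (sp0 X) \<and> f1 \<in> pts (sp1 X)},
      nrm = (\<lambda>f. Inf {nrm (sp0 X) f0 + nrm (sp1 X) f1 | f0 f1.
                      f0 \<in> pts (sp0 X) \<and> f1 \<in> pts (sp1 X) \<and> f = f0 + f1})\<rparr>"

definition interpolation_couple :: "'a::hausdorff_tvs couple \<Rightarrow> bool" where
  "interpolation_couple X \<longleftrightarrow>
     banach_space (sp0 X) \<and> banach_space (sp1 X) \<and>
     continuously_embedded (sp0 X) \<and> continuously_embedded (sp1 X)"

definition cont_subspace :: "'a nspace \<Rightarrow> 'a nspace \<Rightarrow> bool" where
  "cont_subspace Y Z \<longleftrightarrow> pts Y \<subseteq> pts Z \<and> (\<exists>C. \<forall>f\<in>pts Y. nrm Z f \<le> C * nrm Y f)"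

definition intermediate_space :: "'a::real_vector couple \<Rightarrow> 'a nspace \<Rightarrow> bool" where
  "intermediate_space X Z \<longleftrightarrow>
     banach_space Z \<and> cont_subspace (int_space X) Z \<and> cont_subspace Z (sum_space X)"


section \<open>Banach lattices and order notions\<close>

definition ordset :: "('a \<Rightarrow> 'a \<Rightarrow> bool) \<Rightarrow> 'a set \<Rightarrow> 'a gorder" where
  "ordset r V = \<lparr>carrier = V, eq = (=), le = r\<rparr>"

definition modulus :: "'a::real_vector gorder \<Rightarrow> 'a \<Rightarrow> 'a" where
  "modulus L x = join L x (- x)"

definition banach_lattice :: "('a::real_vector \<Rightarrow> 'a \<Rightarrow> bool) \<Rightarrow> 'a nspace \<Rightarrow> bool" where
  "banach_lattice r Z \<longleftrightarrow>
     banach_space Z \<and>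
     Lattice.lattice (ordset r (pts Z)) \<and>
     (\<forall>x\<in>pts Z. \<forall>y\<in>pts Z. \<forall>z\<in>pts Z. r x y \<longrightarrow> r (x + z) (y + z)) \<and>
     (\<forall>x\<in>pts Z. \<forall>y\<in>pts Z. \<forall>c\<ge>0. r x y \<longrightarrow> r (c *\<^sub>R x) (c *\<^sub>R y)) \<and>
     (\<forall>x\<in>pts Z. \<forall>y\<in>pts Z.
        r (modulus (ordset r (pts Z)) x) (modulus (ordset r (pts Z)) y) \<longrightarrow> nrm Z x \<le> nrm Z y)"

definition order_ideal :: "'a::real_vector gorder \<Rightarrow> 'a set \<Rightarrow> bool" where
  "order_ideal L I \<longleftrightarrow>
     I \<subseteq> carrier L \<and> subspace I \<and>
     (\<forall>x\<in>carrier L. \<forall>y\<in>I. le L (modulus L x) (modulus L y) \<longrightarrow> x \<in> I)"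

definition sum_ord :: "'a::real_vector couple \<Rightarrow> 'a gorder" where
  "sum_ord X = ordset (leq X) (pts (sum_space X))"

definition compatible_banach_lattices :: "'a::hausdorff_tvs couple \<Rightarrow> bool" where
  "compatible_banach_lattices X \<longleftrightarrow>
     interpolation_couple X \<and>
     banach_lattice (leq X) (sp0 X) \<and> banach_lattice (leq X) (sp1 X) \<and>
     banach_lattice (leq X) (sum_space X) \<and>
     order_ideal (sum_ord X) (pts (sp0 X)) \<and> order_ideal (sum_ord X) (pts (sp1 X))"

definition pos_part :: "'a::real_vector couple \<Rightarrow> 'a \<Rightarrow> 'a" where
  "pos_part X f = join (sum_ord X) f 0"

definition neg_part :: "'a::real_vector couple \<Rightarrow> 'a \<Rightarrow> 'a" where
  "neg_part X f = join (sum_ord X) (- f) 0"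

definition sigma_dedekind_complete :: "('a \<Rightarrow> 'a \<Rightarrow> bool) \<Rightarrow> 'a nspace \<Rightarrow> bool" where
  "sigma_dedekind_complete r Z \<longleftrightarrow>
     (\<forall>A. A \<noteq> {} \<and> countable A \<and> A \<subseteq> pts Z \<and> Upper (ordset r (pts Z)) A \<noteq> {} \<longrightarrow>
        (\<exists>s. least (ordset r (pts Z)) s (Upper (ordset r (pts Z)) A)))"

definition band :: "'a::real_vector gorder \<Rightarrow> 'a set \<Rightarrow> bool" where
  "band L B \<longleftrightarrow>
     order_ideal L B \<and> (\<forall>A s. A \<subseteq> B \<and> least L s (Upper L A) \<longrightarrow> s \<in> B)"

definition principal_band :: "'a::real_vector gorder \<Rightarrow> 'a \<Rightarrow> 'a set" where
  "principal_band L u = \<Inter>{B. band L B \<and> u \<in> B}"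

definition disjoint_complement :: "'a::real_vector gorder \<Rightarrow> 'a set \<Rightarrow> 'a set" where
  "disjoint_complement L B = {x \<in> carrier L. \<forall>b\<in>B. meet L (modulus L x) (modulus L b) = 0}"

text \<open>Since a band meets its disjoint complement only in 0, the following determines \<open>P\<close> on the
  carrier: it is the projection along the decomposition of the carrier into \<open>B\<close> and its disjoint
  complement (whose existence is part of the condition).\<close>

definition band_projection :: "'a::real_vector gorder \<Rightarrow> 'a set \<Rightarrow> ('a \<Rightarrow> 'a) \<Rightarrow> bool" where
  "band_projection L B P \<longleftrightarrow>
     (\<forall>f\<in>carrier L. P f \<in> B \<and> f - P f \<in> disjoint_complement L B)"

definition principal_band_projection :: "'a::real_vector couple \<Rightarrow> ('a \<Rightarrow> 'a) \<Rightarrow> bool" where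
  "principal_band_projection X P \<longleftrightarrow>
     (\<exists>u\<in>pts (sum_space X). band_projection (sum_ord X) (principal_band (sum_ord X) u) P)"


section \<open>K-functional\<close>

definition Kfun :: "'a::real_vector couple \<Rightarrow> 'a \<Rightarrow> real \<Rightarrow> real" where
  "Kfun X f t = Inf {nrm (sp0 X) f0 + t * nrm (sp1 X) f1 | f0 f1.
                     f0 \<in> pts (sp0 X) \<and> f1 \<in> pts (sp1 X) \<and> f = f0 + f1}"

definition K_dominated :: "'a::real_vector couple \<Rightarrow> 'a \<Rightarrow> 'a \<Rightarrow> bool" where
  "K_dominated X g f \<longleftrightarrow>
     (\<forall>t>0. Kfun X (pos_part X g) t \<le> Kfun X (pos_part X f) t) \<and>
     (\<forall>t>0. Kfun X (neg_part X g) t \<le> Kfun X (neg_part X f) t)"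

definition exact_partially_K_monotone :: "'a::real_vector couple \<Rightarrow> 'a nspace \<Rightarrow> bool" where
  "exact_partially_K_monotone X Z \<longleftrightarrow>
     (\<forall>f\<in>pts Z. \<forall>g\<in>pts (sum_space X).
        K_dominated X g f \<longrightarrow> g \<in> pts Z \<and> nrm Z g \<le> nrm Z f)"


section \<open>Nonlinear operators\<close>

text \<open>An operator is a pair of its domain \<open>D\<close> and a function \<open>S\<close> considered on \<open>D\<close> only.\<close>

definition operator_on :: "'a::real_vector couple \<Rightarrow> 'a set \<Rightarrow> ('a \<Rightarrow> 'a) \<Rightarrow> bool" where
  "operator_on X D S \<longleftrightarrow>
     D \<noteq> {} \<and> D \<subseteq> pts (sum_space X) \<and> S ` D \<subseteq> pts (sum_space X)"

definition GP_bound :: "'a::real_vector couple \<Rightarrow> 'a set \<Rightarrow> ('a \<Rightarrow> 'a) \<Rightarrow> real \<Rightarrow> bool" where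
  "GP_bound X D S C \<longleftrightarrow>
     0 \<le> C \<and>
     (\<forall>f\<in>D. \<forall>f0\<in>pts (sp0 X). \<forall>f1\<in>pts (sp1 X). \<forall>e>0. f = f0 + f1 \<longrightarrow>
        (\<exists>g0\<in>pts (sp0 X). \<exists>g1\<in>pts (sp1 X). S f = g0 + g1 \<and>
           nrm (sp0 X) (pos_part X g0) \<le> C * nrm (sp0 X) (pos_part X f0) + e \<and>
           nrm (sp0 X) (neg_part X g0) \<le> C * nrm (sp0 X) (neg_part X f0) + e \<and>
           nrm (sp1 X) (pos_part X g1) \<le> C * nrm (sp1 X) (pos_part X f1) + e \<and>
           nrm (sp1 X) (neg_part X g1) \<le> C * nrm (sp1 X) (neg_part X f1) + e))"

definition positive_GP :: "'a::real_vector couple \<Rightarrow> 'a set \<Rightarrow> ('a \<Rightarrow> 'a) \<Rightarrow> bool" where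
  "positive_GP X D S \<longleftrightarrow> operator_on X D S \<and> (\<exists>C. GP_bound X D S C)"

definition GP_norm :: "'a::real_vector couple \<Rightarrow> 'a set \<Rightarrow> ('a \<Rightarrow> 'a) \<Rightarrow> real" where
  "GP_norm X D S = (LEAST C. GP_bound X D S C)"

definition exact_interpolation_GP :: "'a::real_vector couple \<Rightarrow> 'a nspace \<Rightarrow> bool" where
  "exact_interpolation_GP X Z \<longleftrightarrow>
     (\<forall>D S. positive_GP X D S \<longrightarrow>
        (\<forall>f\<in>pts Z \<inter> D. S f \<in> pts Z \<and> nrm Z (S f) \<le> GP_norm X D S * nrm Z f))"

text \<open>The inequality \<open>\<parallel>S f - S h\<parallel> \<le> C \<parallel>f - h\<parallel>\<close> in \<open>Z\<close> with the convention that the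
  right-hand side is infinite (also for \<open>C = 0\<close>) if \<open>f - h\<close> is not in \<open>Z\<close>.\<close>

definition lip_ineq :: "'a::real_vector nspace \<Rightarrow> ('a \<Rightarrow> 'a) \<Rightarrow> real \<Rightarrow> 'a \<Rightarrow> 'a \<Rightarrow> bool" where
  "lip_ineq Z S C f h \<longleftrightarrow>
     (f - h \<in> pts Z \<longrightarrow> S f - S h \<in> pts Z \<and> nrm Z (S f - S h) \<le> C * nrm Z (f - h))"

definition Lip_bound :: "'a::real_vector couple \<Rightarrow> 'a set \<Rightarrow> ('a \<Rightarrow> 'a) \<Rightarrow> real \<Rightarrow> bool" where
  "Lip_bound X D S C \<longleftrightarrow>
     0 \<le> C \<and> (\<forall>f\<in>D. \<forall>h\<in>D. lip_ineq (sp0 X) S C f h \<and> lip_ineq (sp1 X) S C f h)"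

definition admissible_Lipschitz :: "'a::real_vector couple \<Rightarrow> 'a set \<Rightarrow> ('a \<Rightarrow> 'a) \<Rightarrow> bool" where
  "admissible_Lipschitz X D S \<longleftrightarrow> operator_on X D S \<and> (\<exists>C. Lip_bound X D S C)"

definition Lip_norm :: "'a::real_vector couple \<Rightarrow> 'a set \<Rightarrow> ('a \<Rightarrow> 'a) \<Rightarrow> real" where
  "Lip_norm X D S = (LEAST C. Lip_bound X D S C)"

definition order_preserving :: "'a couple \<Rightarrow> 'a set \<Rightarrow> ('a \<Rightarrow> 'a) \<Rightarrow> bool" where
  "order_preserving X D S \<longleftrightarrow> (\<forall>f\<in>D. \<forall>g\<in>D. leq X g f \<longrightarrow> leq X (S g) (S f))"

definition solid_lattice :: "'a::real_vector couple \<Rightarrow> 'a set \<Rightarrow> bool" where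
  "solid_lattice X D \<longleftrightarrow>
     D \<subseteq> pts (sum_space X) \<and>
     (\<forall>f\<in>D. \<forall>g\<in>D. \<forall>h\<in>pts (sum_space X). leq X g h \<and> leq X h f \<longrightarrow> h \<in> D) \<and>
     (\<forall>f\<in>D. \<forall>g\<in>D. join (sum_ord X) f g \<in> D \<and> meet (sum_ord X) f g \<in> D)"

definition exact_interpolation_Lip :: "'a::real_vector couple \<Rightarrow> 'a nspace \<Rightarrow> bool" where
  "exact_interpolation_Lip X Z \<longleftrightarrow>
     (\<forall>D S. admissible_Lipschitz X D S \<and> order_preserving X D S \<and> solid_lattice X D \<longrightarrow>
        (\<forall>f\<in>D. \<forall>h\<in>D. lip_ineq Z S (Lip_norm X D S) f h))"


section \<open>Linear operators between couples\<close>

definition bounded_op :: "'a nspace \<Rightarrow> 'a nspace \<Rightarrow> ('a \<Rightarrow> 'a) \<Rightarrow> bool" where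
  "bounded_op Y Z S \<longleftrightarrow>
     S ` pts Y \<subseteq> pts Z \<and> (\<exists>C. \<forall>f\<in>pts Y. nrm Z (S f) \<le> C * nrm Y f)"

definition op_norm :: "'a nspace \<Rightarrow> 'a nspace \<Rightarrow> ('a \<Rightarrow> 'a) \<Rightarrow> real" where
  "op_norm Y Z S = Sup {nrm Z (S f) | f. f \<in> pts Y \<and> nrm Y f \<le> 1}"

definition couple_ops :: "'a::real_vector couple \<Rightarrow> 'a couple \<Rightarrow> ('a \<Rightarrow> 'a) set" where
  "couple_ops X Y = {S.
     S ` pts (sum_space X) \<subseteq> pts (sum_space Y) \<and>
     (\<forall>f\<in>pts (sum_space X). \<forall>g\<in>pts (sum_space X). S (f + g) = S f + S g) \<and>
     (\<forall>f\<in>pts (sum_space X). \<forall>c. S (c *\<^sub>R f) = c *\<^sub>R S f) \<and>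
     bounded_op (sp0 X) (sp0 Y) S \<and> bounded_op (sp1 X) (sp1 Y) S}"

definition couple_norm :: "'a couple \<Rightarrow> 'a couple \<Rightarrow> ('a \<Rightarrow> 'a) \<Rightarrow> real" where
  "couple_norm X Y S = max (op_norm (sp0 X) (sp0 Y) S) (op_norm (sp1 X) (sp1 Y) S)"

definition pos_couple_ops :: "'a::real_vector couple \<Rightarrow> 'a couple \<Rightarrow> ('a \<Rightarrow> 'a) set" where
  "pos_couple_ops X Y =
     {S \<in> couple_ops X Y. \<forall>f\<in>pts (sum_space X). leq X 0 f \<longrightarrow> leq Y 0 (S f)}"

definition exact_interpolation_pos_linear :: "'a::real_vector couple \<Rightarrow> 'a nspace \<Rightarrow> bool" where
  "exact_interpolation_pos_linear X Z \<longleftrightarrow>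
     (\<forall>S\<in>pos_couple_ops X X. bounded_op Z Z S \<and> op_norm Z Z S \<le> couple_norm X X S)"

definition exact_positive_CM_couple :: "'a::real_vector couple \<Rightarrow> bool" where
  "exact_positive_CM_couple X \<longleftrightarrow>
     (\<forall>f\<in>pts (sum_space X). \<forall>g\<in>pts (sum_space X).
        leq X 0 f \<and> leq X 0 g \<and> (\<forall>t>0. Kfun X g t \<le> Kfun X f t) \<longrightarrow>
        (\<exists>T\<in>pos_couple_ops X X. couple_norm X X T \<le> 1 \<and> T f = g))"

definition image_couple :: "('a \<Rightarrow> 'a) \<Rightarrow> 'a couple \<Rightarrow> 'a couple" where
  "image_couple P X =
     \<lparr>sp0 = \<lparr>pts = P ` pts (sp0 X), nrm = nrm (sp0 X)\<rparr>,
      sp1 = \<lparr>pts = P ` pts (sp1 X), nrm = nrm (sp1 X)\<rparr>,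
      leq = leq X\<rparr>"

definition compl_op :: "('a::real_vector \<Rightarrow> 'a) \<Rightarrow> 'a \<Rightarrow> 'a" where
  "compl_op P f = f - P f"

definition diagonal_contraction_property :: "'a::real_vector couple \<Rightarrow> bool" where
  "diagonal_contraction_property X \<longleftrightarrow>
     (\<forall>P\<in>pos_couple_ops X X. \<forall>Q\<in>pos_couple_ops X X.
        principal_band_projection X P \<and> principal_band_projection X Q \<longrightarrow>
        (\<forall>T1\<in>pos_couple_ops (image_couple P X) (image_couple Q X).
         \<forall>T2\<in>pos_couple_ops (image_couple (compl_op P) X) (image_couple (compl_op Q) X).
           couple_norm (image_couple P X) (image_couple Q X) T1 \<le> 1 \<and>
           couple_norm (image_couple (compl_op P) X) (image_couple (compl_op Q) X) T2 \<le> 1 \<longrightarrow>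
           (let T = (\<lambda>f. Q (T1 (P f)) + compl_op Q (T2 (compl_op P f)))
            in T \<in> couple_ops X X \<and> couple_norm X X T \<le> 1)))"

end

theory Submission
  imports Defs
begin

text \<open>
Everything is reduced to statements about single pairs \<open>(f, h)\<close>. Call \<open>(f, h)\<close> a Gagliardo-Peetre pair
with constant \<open>C\<close> (\<open>GP_pair\<close>) if every splitting \<open>f = f\<^sub>0 + f\<^sub>1\<close> is matched, up to an arbitrarily small
error, by a splitting \<open>h = g\<^sub>0 + g\<^sub>1\<close> with \<open>\<parallel>g\<^sub>i\<^sup>\<plusminus>\<parallel> \<le> C \<parallel>f\<^sub>i\<^sup>\<plusminus>\<parallel>\<close>. A positive Gagliardo-Peetre operator is a
function all of whose pairs \<open>(f, S f)\<close> share a constant, and conversely a single pair is such an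
operator with a one-point domain.

A pair has constant 1 if and only if \<open>h\<close> is dominated by \<open>f\<close> in the partial K-order, which gives the
equivalence of partial K-monotonicity and interpolation for Gagliardo-Peetre operators. In one
direction, positive splittings of \<open>f\<^sup>+\<close> and \<open>f\<^sup>-\<close> can be chosen independently and subtracted
(\<open>signed_split\<close>, \<open>GP_pair_imp_K_dominated\<close>). In the other direction the K-functional of \<open>h\<^sup>+\<close> determines,
up to closure, the convex set of norm pairs that splittings of \<open>h\<^sup>+\<close> attain (\<open>gagliardo_split\<close>,
\<open>K_dominated_imp_GP_pair\<close>).

For an order preserving Lipschitz operator \<open>S\<close> on a solid lattice, \<open>(f - h, S f - S h)\<close> is a
Gagliardo-Peetre pair with the Lipschitz constant: a splitting of \<open>(f - h)\<^sup>+\<close> into positive parts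
defines an intermediate point on the way from \<open>h\<close> up to \<open>f \<curlyvee> h\<close>, and the two increments of \<open>S\<close> split a
bound of \<open>(S f - S h)\<^sup>+\<close> (\<open>order_preserving_Lip_split\<close>). Positive linear operators are a special case of
these.

To return from positive linear operators to K-monotonicity, let \<open>g\<close> be dominated by \<open>f\<close>. The
Calderon-Mityagin property maps \<open>f\<^sup>+\<close> to \<open>g\<^sup>+\<close> and \<open>f\<^sup>-\<close> to \<open>g\<^sup>-\<close> by two positive contractions. The bands
generated by \<open>f\<^sup>+\<close> and \<open>g\<^sup>+\<close> separate the signs, and the diagonal contraction property merges the two
operators into one positive contraction that maps \<open>f\<close> to \<open>g\<close>. The countable completeness of \<open>X\<^sub>0\<close> and
\<open>X\<^sub>1\<close> is what makes the projections onto these bands exist: the component of \<open>x \<ge> 0\<close> in the band of \<open>u\<close>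
is \<open>sup\<^sub>n (x \<curlywedge> n u)\<close>.
\<close>

section \<open>Vector lattices on a carrier set\<close>

locale vector_lattice =
  fixes V :: "'a::real_vector set" and le :: "'a \<Rightarrow> 'a \<Rightarrow> bool"  (infix "\<preceq>" 50)
  assumes subspace: "subspace V"
    and lattice: "Lattice.lattice (ordset le V)"
    and add_right_mono: "\<lbrakk>x \<in> V; y \<in> V; z \<in> V; x \<preceq> y\<rbrakk> \<Longrightarrow> x + z \<preceq> y + z"
    and scaleR_mono: "\<lbrakk>x \<in> V; y \<in> V; 0 \<le> c; x \<preceq> y\<rbrakk> \<Longrightarrow> c *\<^sub>R x \<preceq> c *\<^sub>R y"
begin

abbreviation L :: "'a gorder" where "L \<equiv> ordset le V"
abbreviation jn :: "'a \<Rightarrow> 'a \<Rightarrow> 'a"  (infixl "\<curlyvee>" 66) where "x \<curlyvee> y \<equiv> join L x y"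
abbreviation mt :: "'a \<Rightarrow> 'a \<Rightarrow> 'a"  (infixl "\<curlywedge>" 68) where "x \<curlywedge> y \<equiv> meet L x y"
abbreviation pos :: "'a \<Rightarrow> 'a" where "pos x \<equiv> x \<curlyvee> 0"
abbreviation neg :: "'a \<Rightarrow> 'a" where "neg x \<equiv> (- x) \<curlyvee> 0"
abbreviation md :: "'a \<Rightarrow> 'a" where "md \<equiv> modulus L"

sublocale ord: Lattice.lattice "ordset le V"
  rewrites "carrier (ordset le V) = V" and "Order.le (ordset le V) = le"
  by (rule lattice) (simp_all add: ordset_def)

declare ord.le_antisym [rule del]

lemma zero_mem [simp, intro]: "0 \<in> V"
  using subspace by (rule subspace_0)

lemma add_mem [simp, intro]: "x \<in> V \<Longrightarrow> y \<in> V \<Longrightarrow> x + y \<in> V"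
  using subspace by (rule subspace_add)

lemma diff_mem [simp, intro]: "x \<in> V \<Longrightarrow> y \<in> V \<Longrightarrow> x - y \<in> V"
  using subspace by (rule subspace_diff)

lemma uminus_mem [simp, intro]: "x \<in> V \<Longrightarrow> - x \<in> V"
  using subspace by (rule subspace_neg)

lemma scaleR_mem [simp, intro]: "x \<in> V \<Longrightarrow> c *\<^sub>R x \<in> V"
  using subspace by (rule subspace_scale)

lemma md_mem [simp, intro]: "x \<in> V \<Longrightarrow> md x \<in> V"
  by (simp add: modulus_def)

lemma le_diff_iff: assumes "x \<in> V" "y \<in> V" shows "x \<preceq> y \<longleftrightarrow> 0 \<preceq> y - x"
  using add_right_mono[of x y "- x"] add_right_mono[of 0 "y - x" x] assms by auto

lemma add_nonneg: "\<lbrakk>x \<in> V; y \<in> V; 0 \<preceq> x; 0 \<preceq> y\<rbrakk> \<Longrightarrow> 0 \<preceq> x + y"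
  using add_right_mono[of 0 x y] ord.le_trans[of 0 y "x + y"] by simp

lemma scaleR_nonneg: "\<lbrakk>x \<in> V; 0 \<le> c; 0 \<preceq> x\<rbrakk> \<Longrightarrow> 0 \<preceq> c *\<^sub>R x"
  using scaleR_mono[of 0 x c] by simp

text \<open>An order relation between linear expressions depends only on the difference of its two sides. This
lemma and the next replace linear arithmetic: a goal follows from one or two known inequalities
whose differences add up to its own.\<close>

lemma le_if_diff_eq:
  assumes "a \<preceq> b" "y - x = b - a" "a \<in> V" "b \<in> V" "x \<in> V" "y \<in> V"
  shows "x \<preceq> y"
  using assms by (simp add: le_diff_iff[of x y] le_diff_iff[of a b])

lemma le_if_diff_eq_add:
  assumes "a \<preceq> b" "c \<preceq> d" "y - x = (b - a) + (d - c)" "a \<in> V" "b \<in> V" "c \<in> V" "d \<in> V" "x \<in> V" "y \<in> V"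
  shows "x \<preceq> y"
  using assms add_nonneg[of "b - a" "d - c"]
  by (simp add: le_diff_iff[of x y] le_diff_iff[of a b] le_diff_iff[of c d])

lemma add_mono: "\<lbrakk>a \<preceq> b; c \<preceq> d; a \<in> V; b \<in> V; c \<in> V; d \<in> V\<rbrakk> \<Longrightarrow> a + c \<preceq> b + d"
  by (rule le_if_diff_eq_add[of a b c d]) auto

lemma join_least_iff:
  assumes "x \<in> V" "y \<in> V" "z \<in> V"
  shows "x \<curlyvee> y \<preceq> z \<longleftrightarrow> x \<preceq> z \<and> y \<preceq> z"
  using ord.join_le[of x z y] ord.le_trans[OF ord.join_left[of x y], of z]
    ord.le_trans[OF ord.join_right[of x y], of z] assms by auto

lemma le_meet_iff:
  assumes "x \<in> V" "y \<in> V" "z \<in> V"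
  shows "z \<preceq> x \<curlywedge> y \<longleftrightarrow> z \<preceq> x \<and> z \<preceq> y"
  using ord.meet_le[of z x y] ord.le_trans[OF _ ord.meet_left[of x y], of z]
    ord.le_trans[OF _ ord.meet_right[of x y], of z] assms by auto

lemma join_eqI:
  assumes "x \<in> V" "y \<in> V" "s \<in> V" "x \<preceq> s" "y \<preceq> s"
    and "\<And>z. \<lbrakk>z \<in> V; x \<preceq> z; y \<preceq> z\<rbrakk> \<Longrightarrow> s \<preceq> z"
  shows "x \<curlyvee> y = s"
proof (rule ord.le_antisym)
  show "x \<curlyvee> y \<preceq> s" using assms by (simp add: join_least_iff)
  show "s \<preceq> x \<curlyvee> y" by (rule assms(6)) (use assms in \<open>simp_all add: ord.join_left ord.join_right\<close>)
qed (use assms in auto)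

lemma meet_eqI:
  assumes "x \<in> V" "y \<in> V" "s \<in> V" "s \<preceq> x" "s \<preceq> y"
    and "\<And>z. \<lbrakk>z \<in> V; z \<preceq> x; z \<preceq> y\<rbrakk> \<Longrightarrow> z \<preceq> s"
  shows "x \<curlywedge> y = s"
proof (rule ord.le_antisym)
  show "s \<preceq> x \<curlywedge> y" using assms by (simp add: le_meet_iff)
  show "x \<curlywedge> y \<preceq> s" by (rule assms(6)) (use assms in \<open>simp_all add: ord.meet_left ord.meet_right\<close>)
qed (use assms in auto)

lemma join_add: assumes "x \<in> V" "y \<in> V" "z \<in> V" shows "(x + z) \<curlyvee> (y + z) = x \<curlyvee> y + z"
proof (rule join_eqI)
  fix w assume w: "w \<in> V" "x + z \<preceq> w" "y + z \<preceq> w"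
  have "x \<preceq> w - z" by (rule le_if_diff_eq[OF w(2)]) (use w assms in auto)
  moreover have "y \<preceq> w - z" by (rule le_if_diff_eq[OF w(3)]) (use w assms in auto)
  ultimately have "x \<curlyvee> y \<preceq> w - z" using w assms by (simp add: join_least_iff)
  then show "x \<curlyvee> y + z \<preceq> w" by (rule le_if_diff_eq) (use w assms in auto)
qed (use assms in \<open>simp_all add: add_right_mono ord.join_left ord.join_right\<close>)

text \<open>The map \<open>z \<mapsto> x + y - z\<close> reverses the order and swaps \<open>x\<close> and \<open>y\<close>, so it turns their join into
their meet.\<close>

lemma meet_conv_join: assumes "x \<in> V" "y \<in> V" shows "x \<curlywedge> y = x + y - x \<curlyvee> y"
proof (rule meet_eqI)
  show "x + y - x \<curlyvee> y \<preceq> x" using ord.join_right[of x y] by (rule le_if_diff_eq) (use assms in auto)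
  show "x + y - x \<curlyvee> y \<preceq> y" using ord.join_left[of x y] by (rule le_if_diff_eq) (use assms in auto)
next
  fix z assume z: "z \<in> V" "z \<preceq> x" "z \<preceq> y"
  have "x \<preceq> x + y - z" by (rule le_if_diff_eq[OF z(3)]) (use assms z in auto)
  moreover have "y \<preceq> x + y - z" by (rule le_if_diff_eq[OF z(2)]) (use assms z in auto)
  ultimately have "x \<curlyvee> y \<preceq> x + y - z" using z assms by (simp add: join_least_iff)
  then show "z \<preceq> x + y - x \<curlyvee> y" by (rule le_if_diff_eq) (use assms z in auto)
qed (use assms in auto)

lemma pos_nonneg [simp]: "x \<in> V \<Longrightarrow> 0 \<preceq> pos x"
  by (rule ord.join_right) auto

lemma le_pos [simp]: "x \<in> V \<Longrightarrow> x \<preceq> pos x"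
  by (rule ord.join_left) auto

lemma pos_minus_neg: assumes "x \<in> V" shows "pos x - neg x = x"
  using join_add[of "- x" 0 x] assms by (simp add: join_comm[of L 0])

lemma pos_le: "\<lbrakk>x \<in> V; a \<in> V; x \<preceq> a; 0 \<preceq> a\<rbrakk> \<Longrightarrow> pos x \<preceq> a"
  by (simp add: join_least_iff)

lemma pos_mono: "\<lbrakk>x \<in> V; y \<in> V; x \<preceq> y\<rbrakk> \<Longrightarrow> pos x \<preceq> pos y"
  by (rule pos_le) (auto intro: ord.le_trans[of x y])

lemma pos_of_nonneg: "\<lbrakk>x \<in> V; 0 \<preceq> x\<rbrakk> \<Longrightarrow> pos x = x"
  by (rule join_eqI) auto

lemma neg_of_nonneg: "\<lbrakk>x \<in> V; 0 \<preceq> x\<rbrakk> \<Longrightarrow> neg x = 0"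
  using pos_minus_neg[of x] pos_of_nonneg[of x] by simp

lemma pos_add_le: assumes "x \<in> V" "y \<in> V" shows "pos (x + y) \<preceq> pos x + pos y"
  by (rule pos_le) (use assms in \<open>auto intro: add_mono add_nonneg\<close>)

lemma pos_scaleR: assumes "x \<in> V" "0 < c" shows "pos (c *\<^sub>R x) = c *\<^sub>R pos x"
proof (rule join_eqI)
  fix z assume z: "z \<in> V" "c *\<^sub>R x \<preceq> z" "0 \<preceq> z"
  have "x \<preceq> (1/c) *\<^sub>R z" using scaleR_mono[of "c *\<^sub>R x" z "1/c"] z assms by simp
  moreover have "0 \<preceq> (1/c) *\<^sub>R z" using z assms by (simp add: scaleR_nonneg)
  ultimately have "pos x \<preceq> (1/c) *\<^sub>R z" using z assms by (intro pos_le) auto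
  then show "c *\<^sub>R pos x \<preceq> z"
    using scaleR_mono[of "pos x" "(1/c) *\<^sub>R z" c] z assms by simp
qed (use assms in \<open>auto intro: scaleR_mono scaleR_nonneg\<close>)

text \<open>\<open>\<bar>x\<bar> = x \<curlyvee> -x\<close> is the translate by \<open>-x\<close> of \<open>2x \<curlyvee> 0 = 2x\<^sup>+\<close>.\<close>

lemma md_eq: assumes "x \<in> V" shows "md x = pos x + neg x"
proof -
  have "md x = (2 *\<^sub>R x) \<curlyvee> 0 + - x"
    using join_add[of "2 *\<^sub>R x" 0 "- x"] assms by (simp add: modulus_def scaleR_2)
  also have "\<dots> = pos x + pos x - x"
    using pos_scaleR[of x 2] assms by (simp add: scaleR_2)
  also have "\<dots> = pos x + neg x"
    using pos_minus_neg[of x] assms by (simp add: algebra_simps)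
  finally show ?thesis .
qed

lemma md_nonneg [simp]: "x \<in> V \<Longrightarrow> 0 \<preceq> md x"
  by (simp add: md_eq add_nonneg)

lemma md_of_nonneg: "\<lbrakk>x \<in> V; 0 \<preceq> x\<rbrakk> \<Longrightarrow> md x = x"
  by (simp add: md_eq pos_of_nonneg neg_of_nonneg)

lemma md_minus: "md (- x) = md x"
  by (simp add: modulus_def join_comm)

lemma md_md [simp]: "x \<in> V \<Longrightarrow> md (md x) = md x"
  by (simp add: md_of_nonneg)

lemma le_md [simp]: "x \<in> V \<Longrightarrow> x \<preceq> md x"
  by (simp add: modulus_def ord.join_left)

lemma uminus_le_md [simp]: "x \<in> V \<Longrightarrow> - x \<preceq> md x"
  by (simp add: modulus_def ord.join_right)

lemma md_le_iff: "\<lbrakk>x \<in> V; a \<in> V\<rbrakk> \<Longrightarrow> md x \<preceq> a \<longleftrightarrow> x \<preceq> a \<and> - x \<preceq> a"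
  by (simp add: modulus_def join_least_iff)

lemma md_eq_0: assumes "x \<in> V" "md x = 0" shows "x = 0"
proof (rule ord.le_antisym)
  show "x \<preceq> 0" using le_md[of x] assms by simp
  show "0 \<preceq> x" by (rule le_if_diff_eq[OF uminus_le_md[of x]]) (use assms in auto)
qed (use assms in auto)

lemma md_add_le: assumes "x \<in> V" "y \<in> V" shows "md (x + y) \<preceq> md x + md y"
  using assms add_mono[of x "md x" y "md y"] add_mono[of "- x" "md x" "- y" "md y"]
  by (simp add: md_le_iff)

lemma md_scaleR: assumes "x \<in> V" shows "md (c *\<^sub>R x) = \<bar>c\<bar> *\<^sub>R md x"
proof -
  have *: "md (d *\<^sub>R x) = d *\<^sub>R md x" if "0 < d" for d
    using pos_scaleR[of x d] pos_scaleR[of "- x" d] assms that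
    by (simp add: md_eq scaleR_add_right)
  consider "c = 0" | "0 < c" | "c < 0" by linarith
  then show ?thesis
  proof cases
    case 1 then show ?thesis by (simp add: md_of_nonneg)
  next
    case 2 then show ?thesis by (simp add: *)
  next
    case 3 then show ?thesis using *[of "- c"] md_minus[of "c *\<^sub>R x"] by simp
  qed
qed

lemma pos_le_md: "x \<in> V \<Longrightarrow> pos x \<preceq> md x"
  by (intro pos_le) auto

lemma neg_le_md: "x \<in> V \<Longrightarrow> neg x \<preceq> md x"
  by (intro pos_le) auto

lemma meet_mono:
  assumes "a \<preceq> b" "c \<preceq> d" "a \<in> V" "b \<in> V" "c \<in> V" "d \<in> V"
  shows "a \<curlywedge> c \<preceq> b \<curlywedge> d"
  using assms ord.le_trans[OF ord.meet_left[of a c] assms(1)]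
    ord.le_trans[OF ord.meet_right[of a c] assms(2)]
  by (simp add: le_meet_iff)

lemma diff_meet: assumes "x \<in> V" "y \<in> V" shows "x - x \<curlywedge> y = pos (x - y)"
  using join_add[of x y "- y"] assms by (simp add: meet_conv_join)

text \<open>The witnesses are \<open>u = x \<curlywedge> a\<close> and \<open>v = x - x \<curlywedge> a = (x - a)\<^sup>+\<close>.\<close>

lemma riesz_decomposition:
  assumes "x \<in> V" "a \<in> V" "b \<in> V" "0 \<preceq> x" "0 \<preceq> a" "0 \<preceq> b" "x \<preceq> a + b"
  shows "\<exists>u\<in>V. \<exists>v\<in>V. x = u + v \<and> 0 \<preceq> u \<and> u \<preceq> a \<and> 0 \<preceq> v \<and> v \<preceq> b"
proof (intro bexI conjI)
  show "x = x \<curlywedge> a + pos (x - a)"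
    using assms by (simp flip: diff_meet)
  have "x - a \<preceq> b" by (rule le_if_diff_eq[OF assms(7)]) (use assms in auto)
  then show "pos (x - a) \<preceq> b" using assms by (intro pos_le) simp_all
  show "0 \<preceq> x \<curlywedge> a" using assms by (simp add: le_meet_iff)
  show "x \<curlywedge> a \<preceq> a" using assms by (simp add: ord.meet_right)
qed (use assms in simp_all)

text \<open>Splitting \<open>(a + b) \<curlywedge> c\<close> below \<open>a + b\<close> gives one part below \<open>a\<close> and one below \<open>b\<close>, and both parts stay
below \<open>c\<close>. It makes disjointness additive.\<close>

lemma meet_add_le:
  assumes "a \<in> V" "b \<in> V" "c \<in> V" "0 \<preceq> a" "0 \<preceq> b" "0 \<preceq> c"
  shows "(a + b) \<curlywedge> c \<preceq> a \<curlywedge> c + b \<curlywedge> c"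
proof -
  have "0 \<preceq> (a + b) \<curlywedge> c" using assms by (simp add: le_meet_iff add_nonneg)
  moreover have "(a + b) \<curlywedge> c \<preceq> a + b" using assms by (simp add: ord.meet_left)
  ultimately have "\<exists>u\<in>V. \<exists>v\<in>V. (a + b) \<curlywedge> c = u + v \<and> 0 \<preceq> u \<and> u \<preceq> a \<and> 0 \<preceq> v \<and> v \<preceq> b"
    using assms by (intro riesz_decomposition) simp_all
  then obtain u v where uv: "u \<in> V" "v \<in> V" "(a + b) \<curlywedge> c = u + v"
      "0 \<preceq> u" "u \<preceq> a" "0 \<preceq> v" "v \<preceq> b"
    by blast
  have c: "u + v \<preceq> c" using uv(3) assms ord.meet_right[of "a + b" c] by simp
  have "u \<preceq> c" by (rule le_if_diff_eq_add[OF c uv(6)]) (use uv assms in auto)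
  moreover have "v \<preceq> c" by (rule le_if_diff_eq_add[OF c uv(4)]) (use uv assms in auto)
  ultimately have "u \<preceq> a \<curlywedge> c" "v \<preceq> b \<curlywedge> c" using uv assms by (simp_all add: le_meet_iff)
  then show ?thesis unfolding uv(3) by (rule add_mono) (use uv assms in simp_all)
qed

section \<open>Bands and band projections\<close>

definition is_supremum :: "'a set \<Rightarrow> 'a \<Rightarrow> bool" where
  "is_supremum A s \<longleftrightarrow> s \<in> V \<and> (\<forall>x\<in>A. x \<preceq> s) \<and> (\<forall>y\<in>V. (\<forall>x\<in>A. x \<preceq> y) \<longrightarrow> s \<preceq> y)"

lemma least_Upper_iff: "A \<subseteq> V \<Longrightarrow> least L s (Upper L A) \<longleftrightarrow> is_supremum A s"
  by (auto simp: least_def Upper_def is_supremum_def ordset_def subset_iff)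

lemma order_ideal_iff:
  "order_ideal L I \<longleftrightarrow>
     I \<subseteq> V \<and> Real_Vector_Spaces.subspace I \<and> (\<forall>x\<in>V. \<forall>y\<in>I. md x \<preceq> md y \<longrightarrow> x \<in> I)"
  by (simp add: order_ideal_def ordset_def)

lemma order_ideal_mem: "\<lbrakk>order_ideal L I; x \<in> V; y \<in> I; md x \<preceq> md y\<rbrakk> \<Longrightarrow> x \<in> I"
  by (auto simp: order_ideal_iff)

lemma disjoint_complement_iff:
  "x \<in> disjoint_complement L B \<longleftrightarrow> x \<in> V \<and> (\<forall>b\<in>B. md x \<curlywedge> md b = 0)"
  by (auto simp: disjoint_complement_def ordset_def)

lemma meet_eq_0I: "\<lbrakk>x \<in> V; y \<in> V; 0 \<preceq> x; 0 \<preceq> y; x \<curlywedge> y \<preceq> 0\<rbrakk> \<Longrightarrow> x \<curlywedge> y = 0"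
  by (rule ord.le_antisym) (simp_all add: le_meet_iff)

lemma pos_meet_neg: assumes "x \<in> V" shows "pos x \<curlywedge> neg x = 0"
  using diff_meet[of "pos x" "neg x"] pos_minus_neg[of x] assms by simp

lemma meet_scaleR_eq_0:
  assumes "x \<in> V" "y \<in> V" "0 \<preceq> x" "0 \<preceq> y" "x \<curlywedge> y = 0" "0 \<le> c"
  shows "(c *\<^sub>R x) \<curlywedge> y = 0"
proof (rule meet_eq_0I)
  define w where "w = (c *\<^sub>R x) \<curlywedge> y"
  have cx: "0 \<preceq> c *\<^sub>R x" using assms by (simp add: scaleR_nonneg)
  have w: "w \<in> V" "0 \<preceq> w" "w \<preceq> c *\<^sub>R x" "w \<preceq> y"
    using assms cx by (simp_all add: w_def le_meet_iff ord.meet_left ord.meet_right)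
  \<comment> \<open>With \<open>d \<ge> 1\<close> the element \<open>w / d\<close> is still below \<open>y\<close> and also below \<open>x\<close>.\<close>
  define d where "d = c + 1"
  have d: "0 < d" "1 \<le> d" using assms(6) by (simp_all add: d_def)
  have "w \<preceq> d *\<^sub>R x"
    by (rule le_if_diff_eq_add[OF w(3) assms(3)]) (use w assms in \<open>auto simp: d_def scaleR_add_left\<close>)
  then have "(1/d) *\<^sub>R w \<preceq> x"
    using scaleR_mono[of w "d *\<^sub>R x" "1/d"] w assms d by simp
  moreover have "0 \<preceq> (1 - 1/d) *\<^sub>R w" using w d by (intro scaleR_nonneg) auto
  then have "(1/d) *\<^sub>R w \<preceq> y"
    by (rule le_if_diff_eq_add[OF w(4)])
       (use w assms in \<open>auto simp: scaleR_diff_left\<close>)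
  ultimately have "(1/d) *\<^sub>R w \<preceq> x \<curlywedge> y" using assms(1-2) w by (simp add: le_meet_iff)
  then have "(1/d) *\<^sub>R w \<preceq> 0" using assms(5) by simp
  then have "d *\<^sub>R (1/d) *\<^sub>R w \<preceq> d *\<^sub>R 0" using assms w d by (intro scaleR_mono) auto
  then show "(c *\<^sub>R x) \<curlywedge> y \<preceq> 0" using d by (simp add: w_def)
qed (use assms in \<open>simp_all add: scaleR_nonneg\<close>)

lemma order_ideal_disjoint_complement:
  assumes "C \<subseteq> V" shows "order_ideal L (disjoint_complement L C)"
  unfolding order_ideal_iff
proof (intro conjI ballI impI)
  show "disjoint_complement L C \<subseteq> V" by (auto simp: disjoint_complement_iff)
next
  fix x y assume x: "x \<in> V" and y: "y \<in> disjoint_complement L C" and le: "md x \<preceq> md y"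
  have "md x \<curlywedge> md b = 0" if "b \<in> C" for b
  proof (rule meet_eq_0I)
    have b: "b \<in> V" using that assms by auto
    have "md x \<curlywedge> md b \<preceq> md y \<curlywedge> md b"
      using x y b le by (intro meet_mono) (auto simp: disjoint_complement_iff)
    then show "md x \<curlywedge> md b \<preceq> 0" using y that by (simp add: disjoint_complement_iff)
  qed (use x that assms in auto)
  then show "x \<in> disjoint_complement L C" using x by (simp add: disjoint_complement_iff)
next
  show "Real_Vector_Spaces.subspace (disjoint_complement L C)"
  proof (rule subspaceI)
    have "md 0 \<curlywedge> md b = 0" if "b \<in> V" for b
      using that by (intro meet_eq_0I) (auto simp: md_of_nonneg ord.meet_left)
    then show "0 \<in> disjoint_complement L C" using assms by (auto simp: disjoint_complement_iff)
  next
    fix x y assume xy: "x \<in> disjoint_complement L C" "y \<in> disjoint_complement L C"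
    then have V: "x \<in> V" "y \<in> V" by (auto simp: disjoint_complement_iff)
    have "md (x + y) \<curlywedge> md b = 0" if "b \<in> C" for b
    proof (rule meet_eq_0I)
      have b: "b \<in> V" using that assms by auto
      have "md (x + y) \<curlywedge> md b \<preceq> (md x + md y) \<curlywedge> md b"
        using V b by (intro meet_mono md_add_le) auto
      moreover have "(md x + md y) \<curlywedge> md b \<preceq> md x \<curlywedge> md b + md y \<curlywedge> md b"
        using V b by (intro meet_add_le) auto
      moreover have "md x \<curlywedge> md b = 0" "md y \<curlywedge> md b = 0"
        using xy that by (auto simp: disjoint_complement_iff)
      ultimately show "md (x + y) \<curlywedge> md b \<preceq> 0"
        using ord.le_trans[of "md (x + y) \<curlywedge> md b" "(md x + md y) \<curlywedge> md b" 0] V b by simp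
    qed (use V that assms in auto)
    then show "x + y \<in> disjoint_complement L C" using V by (simp add: disjoint_complement_iff)
  next
    fix c x assume x: "x \<in> disjoint_complement L C"
    then have V: "x \<in> V" by (auto simp: disjoint_complement_iff)
    have "md (c *\<^sub>R x) \<curlywedge> md b = 0" if "b \<in> C" for b
      unfolding md_scaleR[OF V]
      by (rule meet_scaleR_eq_0) (use x V that assms in \<open>auto simp: disjoint_complement_iff\<close>)
    then show "c *\<^sub>R x \<in> disjoint_complement L C" using V by (simp add: disjoint_complement_iff)
  qed
qed

lemma order_ideal_md_iff: "\<lbrakk>order_ideal L I; x \<in> V\<rbrakk> \<Longrightarrow> md x \<in> I \<longleftrightarrow> x \<in> I"
  using order_ideal_mem[of I "md x" x] order_ideal_mem[of I x "md x"] by auto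

text \<open>Disjointness from \<open>y\<close> passes to suprema. Put \<open>w = s\<^sup>+ \<curlywedge> y\<close>. For \<open>a \<in> A\<close> the elements \<open>a\<^sup>+\<close> and \<open>w\<close> are
disjoint, so their sum is their join and lies below \<open>s\<^sup>+\<close>. Thus \<open>s\<^sup>+ - w\<close> is still an upper bound of
\<open>A\<close>, which forces \<open>w \<le> 0\<close>.\<close>

lemma disjoint_sup:
  assumes A: "A \<subseteq> V" "is_supremum A s" and y: "y \<in> V" "0 \<preceq> y"
    and disj: "\<And>a. a \<in> A \<Longrightarrow> md a \<curlywedge> y = 0"
  shows "pos s \<curlywedge> y = 0"
proof (rule meet_eq_0I)
  have s: "s \<in> V" "\<And>a. a \<in> A \<Longrightarrow> a \<preceq> s" "\<And>z. \<lbrakk>z \<in> V; \<And>a. a \<in> A \<Longrightarrow> a \<preceq> z\<rbrakk> \<Longrightarrow> s \<preceq> z"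
    using A(2) by (auto simp: is_supremum_def)
  define w where "w = pos s \<curlywedge> y"
  have w: "w \<in> V" "w \<preceq> pos s" "w \<preceq> y"
    using s y by (simp_all add: w_def ord.meet_left ord.meet_right)
  have "a \<preceq> pos s - w" if a: "a \<in> A" for a
  proof -
    have aV: "a \<in> V" using a A by auto
    have "pos a \<curlywedge> w \<preceq> md a \<curlywedge> y" using aV w y by (intro meet_mono) (auto simp: pos_le_md)
    then have "pos a \<curlywedge> w \<preceq> 0" using disj[OF a] by simp
    then have "pos a + w \<preceq> pos a \<curlyvee> w"
      by (rule le_if_diff_eq) (use aV w in \<open>auto simp: meet_conv_join\<close>)
    moreover have "pos a \<preceq> pos s" using aV s(1) s(2)[OF a] by (intro pos_mono)
    then have "pos a \<curlyvee> w \<preceq> pos s" using aV w s(1) by (intro join_least_iff[THEN iffD2]) simp_all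
    ultimately have "pos a + w \<preceq> pos s"
      using aV w s(1) by (intro ord.le_trans[of "pos a + w" "pos a \<curlyvee> w" "pos s"]) simp_all
    then have "pos a \<preceq> pos s - w" by (rule le_if_diff_eq) (use aV w s(1) in auto)
    with aV w s(1) show ?thesis by (intro ord.le_trans[of a "pos a" "pos s - w"]) simp_all
  qed
  then have "s \<preceq> pos s - w" using w s(1) by (intro s(3)) auto
  moreover have "0 \<preceq> pos s - w" by (rule le_if_diff_eq[OF w(2)]) (use w s(1) in auto)
  ultimately have "pos s \<preceq> pos s - w" using s(1) w by (intro pos_le) auto
  then have "w \<preceq> 0" by (rule le_if_diff_eq) (use w s(1) in auto)
  then show "pos s \<curlywedge> y \<preceq> 0" by (simp add: w_def)
  show "pos s \<in> V" "0 \<preceq> pos s" using s(1) by simp_all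
qed (use y in simp_all)

text \<open>For a supremum \<open>s\<close> of \<open>A\<close>, the part \<open>s\<^sup>+\<close> is covered by the previous lemma and \<open>s\<^sup>-\<close> lies below \<open>a\<^sup>-\<close> for
any \<open>a \<in> A\<close>. The empty \<open>A\<close> has a supremum only if the carrier has a least element, and then that
element is 0.\<close>

lemma band_disjoint_complement:
  assumes C: "C \<subseteq> V" shows "band L (disjoint_complement L C)"
  unfolding band_def
proof (intro conjI allI impI order_ideal_disjoint_complement C)
  fix A s assume "A \<subseteq> disjoint_complement L C \<and> least L s (Upper L A)"
  then have sub: "A \<subseteq> disjoint_complement L C" and lub: "least L s (Upper L A)" by auto
  then have A: "A \<subseteq> V" by (auto simp: disjoint_complement_iff)
  then have A: "A \<subseteq> V" "is_supremum A s" using lub by (simp_all add: least_Upper_iff)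
  have ideal: "order_ideal L (disjoint_complement L C)" by (rule order_ideal_disjoint_complement[OF C])
  have sV: "s \<in> V" using A by (simp add: is_supremum_def)
  have subs: "Real_Vector_Spaces.subspace (disjoint_complement L C)"
    using ideal by (simp add: order_ideal_iff)
  show "s \<in> disjoint_complement L C"
  proof (cases "A = {}")
    case True
    then have "\<forall>y\<in>V. s \<preceq> y" using A by (simp add: is_supremum_def)
    then have "s \<preceq> 0" "s \<preceq> s + s" using sV by auto
    moreover have "0 \<preceq> s" using \<open>s \<preceq> s + s\<close> by (rule le_if_diff_eq) (use sV in auto)
    ultimately have "s = 0" using sV by (intro ord.le_antisym) auto
    then show ?thesis using subspace_0[OF subs] by simp
  next
    case False
    then obtain a where a: "a \<in> A" by auto
    have aV: "a \<in> V" using a A by auto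
    have "md (pos s) \<curlywedge> md b = 0" if "b \<in> C" for b
    proof -
      have b: "b \<in> V" using that C by auto
      have "pos s \<curlywedge> md b = 0"
        using A by (rule disjoint_sup) (use sub that b in \<open>auto simp: disjoint_complement_iff\<close>)
      then show ?thesis using sV by (simp add: md_of_nonneg)
    qed
    then have ps: "pos s \<in> disjoint_complement L C" using sV by (simp add: disjoint_complement_iff)
    have "a \<preceq> s" using A a by (simp add: is_supremum_def)
    then have "- s \<preceq> - a" by (rule le_if_diff_eq) (use aV sV in auto)
    then have "neg s \<preceq> neg a" using aV sV by (intro pos_mono) auto
    then have "neg s \<preceq> md a" using aV sV neg_le_md[of a]
      by (intro ord.le_trans[of "neg s" "neg a" "md a"]) simp_all
    then have "md (neg s) \<preceq> md a" using sV by (simp add: md_of_nonneg)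
    then have ns: "neg s \<in> disjoint_complement L C"
      using a sub sV by (intro order_ideal_mem[OF ideal, of "neg s" a]) auto
    have "pos s - neg s \<in> disjoint_complement L C" using ps ns subs by (intro subspace_diff)
    then show ?thesis using sV by (simp add: pos_minus_neg)
  qed
qed

lemma band_carrier: "band L V"
  using subspace by (auto simp: band_def order_ideal_iff least_Upper_iff is_supremum_def)

lemma band_principal_band: assumes "u \<in> V" shows "band L (principal_band L u)"
proof -
  have *: "principal_band L u \<subseteq> V"
    using band_carrier assms by (auto simp: principal_band_def)
  have "Real_Vector_Spaces.subspace (principal_band L u)"
    unfolding principal_band_def by (rule subspace_Inter) (auto simp: band_def order_ideal_iff)
  moreover have "x \<in> principal_band L u"
    if "x \<in> V" "y \<in> principal_band L u" "md x \<preceq> md y" for x y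
    using that by (auto simp: principal_band_def band_def intro: order_ideal_mem)
  ultimately have "order_ideal L (principal_band L u)"
    using * unfolding order_ideal_iff by blast
  moreover have "s \<in> principal_band L u"
    if "A \<subseteq> principal_band L u" "least L s (Upper L A)" for A s
    unfolding principal_band_def
  proof safe
    fix B assume "band L B" "u \<in> B"
    then have "A \<subseteq> B" using that(1) by (auto simp: principal_band_def)
    then show "s \<in> B" using \<open>band L B\<close> that(2) by (simp add: band_def)
  qed
  ultimately show ?thesis unfolding band_def by blast
qed

lemma generator_mem_principal_band: "u \<in> principal_band L u"
  by (simp add: principal_band_def)

text \<open>The disjoint complement of \<open>{x}\<close> is a band; as it contains \<open>u\<close>, it contains the band generated by \<open>u\<close>.\<close>

lemma disjoint_complement_principal_band:
  assumes "u \<in> V" "x \<in> V" "md u \<curlywedge> md x = 0"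
  shows "x \<in> disjoint_complement L (principal_band L u)"
proof -
  have "band L (disjoint_complement L {x})" "u \<in> disjoint_complement L {x}"
    using assms by (auto simp: disjoint_complement_iff intro: band_disjoint_complement)
  then have "principal_band L u \<subseteq> disjoint_complement L {x}"
    by (auto simp: principal_band_def)
  then show ?thesis using assms(2) by (auto simp: disjoint_complement_iff meet_comm)
qed

text \<open>The classical formula \<open>sup\<^sub>n (x \<curlywedge> n u)\<close> for the band component of \<open>x \<ge> 0\<close>. For disjointness of the
rest, put \<open>w = (x - s) \<curlywedge> u\<close>: then \<open>w + x \<curlywedge> n u \<le> x \<curlywedge> (n + 1) u \<le> s\<close> for every \<open>n\<close>, so \<open>s - w\<close> is also an
upper bound of the sequence and \<open>w = 0\<close>.\<close>

lemma principal_band_component: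
  assumes u: "u \<in> V" "0 \<preceq> u" and x: "x \<in> V" "0 \<preceq> x"
    and s: "is_supremum (range (\<lambda>n. x \<curlywedge> (real n *\<^sub>R u))) s"
  shows "s \<in> principal_band L u \<and> x - s \<in> disjoint_complement L (principal_band L u)"
proof
  have band: "band L (principal_band L u)" by (rule band_principal_band[OF u(1)])
  then have ideal: "order_ideal L (principal_band L u)" by (simp add: band_def)
  have nu: "real n *\<^sub>R u \<in> V" "0 \<preceq> real n *\<^sub>R u" for n using u by (simp_all add: scaleR_nonneg)
  have sV: "s \<in> V" using s by (simp add: is_supremum_def)
  have le_s: "x \<curlywedge> (real n *\<^sub>R u) \<preceq> s" for n using s by (simp add: is_supremum_def)
  have "x \<curlywedge> (real n *\<^sub>R u) \<in> principal_band L u" for n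
  proof (rule order_ideal_mem[OF ideal])
    show "real n *\<^sub>R u \<in> principal_band L u"
      using ideal generator_mem_principal_band[of u] by (simp add: order_ideal_iff subspace_scale)
    show "md (x \<curlywedge> (real n *\<^sub>R u)) \<preceq> md (real n *\<^sub>R u)"
      using x nu[of n] by (simp add: md_of_nonneg le_meet_iff ord.meet_right)
  qed (use x nu in simp)
  then have "range (\<lambda>n. x \<curlywedge> (real n *\<^sub>R u)) \<subseteq> principal_band L u" by auto
  moreover have "least L s (Upper L (range (\<lambda>n. x \<curlywedge> (real n *\<^sub>R u))))"
    using s x nu by (subst least_Upper_iff) auto
  ultimately show "s \<in> principal_band L u" using band unfolding band_def by blast
  have "s \<preceq> x" using s x nu by (auto simp: is_supremum_def ord.meet_left)
  then have xs: "0 \<preceq> x - s" by (rule le_if_diff_eq) (use x sV in auto)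
  define w where "w = (x - s) \<curlywedge> u"
  have w: "w \<in> V" "w \<preceq> x - s" "w \<preceq> u"
    using x u sV by (simp_all add: w_def ord.meet_left ord.meet_right)
  have "x \<curlywedge> (real n *\<^sub>R u) \<preceq> s - w" for n
  proof -
    let ?m = "x \<curlywedge> (real n *\<^sub>R u)"
    have m: "?m \<in> V" "?m \<preceq> real n *\<^sub>R u" using x nu[of n] by (simp_all add: ord.meet_right)
    have "w + ?m \<preceq> x" by (rule le_if_diff_eq_add[OF w(2) le_s[of n]]) (use w m x sV in auto)
    moreover have "w + ?m \<preceq> real (Suc n) *\<^sub>R u"
      by (rule le_if_diff_eq_add[OF w(3) m(2)]) (use w m u in \<open>auto simp: scaleR_add_left\<close>)
    ultimately have "w + ?m \<preceq> x \<curlywedge> (real (Suc n) *\<^sub>R u)" using w m x u by (simp add: le_meet_iff)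
    then have "w + ?m \<preceq> s"
      using le_s[of "Suc n"] w m x u sV
      by (intro ord.le_trans[of "w + ?m" "x \<curlywedge> (real (Suc n) *\<^sub>R u)" s]) simp_all
    then show ?thesis by (rule le_if_diff_eq) (use w m sV in auto)
  qed
  then have "s \<preceq> s - w" using s w sV by (simp add: is_supremum_def)
  then have "w \<preceq> 0" by (rule le_if_diff_eq) (use w sV in auto)
  then have "w = 0" using xs x u sV unfolding w_def by (intro meet_eq_0I) auto
  then show "x - s \<in> disjoint_complement L (principal_band L u)"
    using x u sV xs by (intro disjoint_complement_principal_band)
      (auto simp: md_of_nonneg w_def meet_comm)
qed

lemma principal_band_projection_exists:
  assumes u: "u \<in> V" "0 \<preceq> u"
    and sup: "\<And>x. \<lbrakk>x \<in> V; 0 \<preceq> x\<rbrakk> \<Longrightarrow> \<exists>s. is_supremum (range (\<lambda>n. x \<curlywedge> (real n *\<^sub>R u))) s"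
  shows "\<exists>P. band_projection L (principal_band L u) P"
proof -
  let ?B = "principal_band L u"
  have "order_ideal L ?B" using band_principal_band[OF u(1)] by (simp add: band_def)
  moreover from this have "order_ideal L (disjoint_complement L ?B)"
    by (intro order_ideal_disjoint_complement) (simp add: order_ideal_iff)
  ultimately have subs: "Real_Vector_Spaces.subspace ?B" "Real_Vector_Spaces.subspace (disjoint_complement L ?B)"
    by (auto simp: order_ideal_iff)
  have "\<exists>b. b \<in> ?B \<and> f - b \<in> disjoint_complement L ?B" if f: "f \<in> V" for f
  proof -
    obtain a where a: "a \<in> ?B" "pos f - a \<in> disjoint_complement L ?B"
      using principal_band_component[OF u, of "pos f"] sup[of "pos f"] f by auto
    obtain b where b: "b \<in> ?B" "neg f - b \<in> disjoint_complement L ?B"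
      using principal_band_component[OF u, of "neg f"] sup[of "neg f"] f by auto
    have "f - (a - b) = (pos f - a) - (neg f - b)"
      using pos_minus_neg[OF f] by (simp add: algebra_simps)
    then have "f - (a - b) \<in> disjoint_complement L ?B"
      using subspace_diff[OF subs(2) a(2) b(2)] by (simp only:)
    then show ?thesis using subspace_diff[OF subs(1) a(1) b(1)] by blast
  qed
  then have "\<exists>P. \<forall>f\<in>V. P f \<in> ?B \<and> f - P f \<in> disjoint_complement L ?B" by (intro bchoice) blast
  then show ?thesis by (simp add: band_projection_def ordset_def)
qed

text \<open>Positivity gives \<open>\<plusminus>F x \<le> F \<bar>x\<bar>\<close>, and \<open>F \<bar>x\<bar> \<le> \<bar>x\<bar>\<close>. It is applied to a band projection and to its
complement.\<close>

lemma md_le_of_positive_below_identity: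
  assumes mem: "\<And>x. x \<in> V \<Longrightarrow> F x \<in> V"
    and add: "\<And>x y. \<lbrakk>x \<in> V; y \<in> V\<rbrakk> \<Longrightarrow> F (x + y) = F x + F y"
    and nonneg: "\<And>x. \<lbrakk>x \<in> V; 0 \<preceq> x\<rbrakk> \<Longrightarrow> 0 \<preceq> F x"
    and below: "\<And>x. \<lbrakk>x \<in> V; 0 \<preceq> x\<rbrakk> \<Longrightarrow> F x \<preceq> x"
    and x: "x \<in> V"
  shows "md (F x) \<preceq> md x"
proof -
  have F0: "F 0 = 0" using add[of 0 0] by simp
  have Fm: "F (- x) = - F x" using add[of x "- x"] x F0 by (simp add: eq_neg_iff_add_eq_0 add.commute)
  have "0 \<preceq> md x - x" by (rule le_if_diff_eq[OF le_md[OF x]]) (use x in auto)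
  then have "0 \<preceq> F (md x + - x)" using x by (intro nonneg) auto
  then have 1: "0 \<preceq> F (md x) + - F x" using add[of "md x" "- x"] x Fm by simp
  have "0 \<preceq> md x + x" by (rule le_if_diff_eq[OF uminus_le_md[OF x]]) (use x in auto)
  then have "0 \<preceq> F (md x + x)" using x by (intro nonneg) auto
  then have 2: "0 \<preceq> F (md x) + F x" using add[of "md x" x] x by simp
  have b: "F (md x) \<preceq> md x" using x by (intro below) auto
  have "F x \<preceq> md x" by (rule le_if_diff_eq_add[OF b 1]) (use x mem in auto)
  moreover have "- F x \<preceq> md x" by (rule le_if_diff_eq_add[OF b 2]) (use x mem in auto)
  ultimately show ?thesis using x mem by (simp add: md_le_iff)
qed

text \<open>Both \<open>b\<^sup>- \<le> \<bar>b\<bar>\<close> and, because \<open>-b \<le> d\<close>, \<open>b\<^sup>- \<le> \<bar>d\<bar>\<close>.\<close>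

lemma disjoint_component_nonneg:
  assumes "b \<in> V" "d \<in> V" "md b \<curlywedge> md d = 0" "0 \<preceq> b + d"
  shows "0 \<preceq> b"
proof -
  have "- b \<preceq> md d"
    by (rule le_if_diff_eq_add[OF assms(4) le_md[OF assms(2)]]) (use assms in auto)
  then have "- b \<preceq> md b \<curlywedge> md d" using assms(1,2) by (simp add: le_meet_iff)
  then have "- b \<preceq> 0" using assms(3) by simp
  then show ?thesis by (rule le_if_diff_eq) (use assms in auto)
qed

end

text \<open>A band projection is only determined on the carrier, by the decomposition along \<open>B\<close> and its disjoint
complement. Linearity, positivity and the bound \<open>\<bar>P f\<bar> \<le> \<bar>f\<bar>\<close> come from this
decomposition and its uniqueness.\<close>

locale riesz_band_projection = vector_lattice V le
  for V :: "'a::real_vector set" and le :: "'a \<Rightarrow> 'a \<Rightarrow> bool" (infix "\<preceq>" 50) +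
  fixes B :: "'a set" and P :: "'a \<Rightarrow> 'a"
  assumes ideal: "order_ideal (ordset le V) B"
    and proj: "band_projection (ordset le V) B P"
begin

lemma proj_mem_band: "f \<in> V \<Longrightarrow> P f \<in> B"
  and compl_mem: "f \<in> V \<Longrightarrow> f - P f \<in> disjoint_complement L B"
  using proj by (simp_all add: band_projection_def ordset_def)

lemma ideal_compl: "order_ideal L (disjoint_complement L B)"
  using ideal by (intro order_ideal_disjoint_complement) (simp add: order_ideal_iff)

lemma proj_mem [simp]: "f \<in> V \<Longrightarrow> P f \<in> V"
  using proj_mem_band ideal by (auto simp: order_ideal_iff)

lemma proj_eqI: assumes "f \<in> V" "b \<in> B" "f - b \<in> disjoint_complement L B" shows "P f = b"
proof -
  have B: "Real_Vector_Spaces.subspace B" "B \<subseteq> V" using ideal by (simp_all add: order_ideal_iff)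
  have D: "Real_Vector_Spaces.subspace (disjoint_complement L B)" using ideal_compl by (simp add: order_ideal_iff)
  have 1: "P f - b \<in> B" using assms B proj_mem_band by (intro subspace_diff) auto
  have "(f - b) - (f - P f) \<in> disjoint_complement L B"
    by (rule subspace_diff[OF D assms(3) compl_mem[OF assms(1)]])
  then have "P f - b \<in> disjoint_complement L B" by (simp add: algebra_simps)
  then have "md (P f - b) \<curlywedge> md (P f - b) = 0" using 1 by (simp add: disjoint_complement_iff)
  moreover have V: "P f - b \<in> V" using 1 B by auto
  ultimately have "md (P f - b) \<preceq> 0"
    using le_meet_iff[of "md (P f - b)" "md (P f - b)" "md (P f - b)"] by simp
  then have "md (P f - b) = 0" using V by (intro ord.le_antisym) auto
  then show ?thesis using md_eq_0[OF V] by simp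
qed

lemma proj_add: assumes "f \<in> V" "g \<in> V" shows "P (f + g) = P f + P g"
proof (rule proj_eqI)
  have *: "f + g - (P f + P g) = (f - P f) + (g - P g)" by simp
  show "f + g - (P f + P g) \<in> disjoint_complement L B"
    unfolding * using assms compl_mem ideal_compl by (intro subspace_add) (auto simp: order_ideal_iff)
  show "P f + P g \<in> B"
    using assms proj_mem_band ideal by (intro subspace_add) (auto simp: order_ideal_iff)
qed (use assms in simp)

lemma proj_scaleR: assumes "f \<in> V" shows "P (c *\<^sub>R f) = c *\<^sub>R P f"
proof (rule proj_eqI)
  have *: "c *\<^sub>R f - c *\<^sub>R P f = c *\<^sub>R (f - P f)" by (simp add: scaleR_diff_right)
  show "c *\<^sub>R f - c *\<^sub>R P f \<in> disjoint_complement L B"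
    unfolding * using assms compl_mem ideal_compl by (intro subspace_scale) (auto simp: order_ideal_iff)
  show "c *\<^sub>R P f \<in> B"
    using assms proj_mem_band ideal by (intro subspace_scale) (auto simp: order_ideal_iff)
qed (use assms in simp)

lemma proj_nonneg: assumes "f \<in> V" "0 \<preceq> f" shows "0 \<preceq> P f"
  using assms compl_mem[of f] proj_mem_band[of f]
  by (intro disjoint_component_nonneg[of "P f" "f - P f"]) (simp_all add: disjoint_complement_iff meet_comm)

lemma compl_nonneg: assumes "f \<in> V" "0 \<preceq> f" shows "0 \<preceq> f - P f"
  using assms compl_mem[of f] proj_mem_band[of f]
  by (intro disjoint_component_nonneg[of "f - P f" "P f"]) (simp_all add: disjoint_complement_iff)

lemma md_proj_le: "f \<in> V \<Longrightarrow> md (P f) \<preceq> md f"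
  using proj_add proj_nonneg compl_nonneg
  by (intro md_le_of_positive_below_identity) (simp_all add: le_diff_iff[of "P _"])

lemma md_compl_le: "f \<in> V \<Longrightarrow> md (f - P f) \<preceq> md f"
  using proj_add proj_nonneg compl_nonneg
  by (intro md_le_of_positive_below_identity[of "\<lambda>f. f - P f"]) (simp_all add: le_diff_iff[of "_ - P _"])

end

section \<open>Normed ideals and countable suprema\<close>

lemma banach_lattice_vector_lattice: "banach_lattice r Y \<Longrightarrow> vector_lattice (pts Y) r"
  by (rule vector_lattice.intro) (simp_all add: banach_lattice_def banach_space_def)

context vector_lattice
begin

definition ideal_space :: "'a nspace \<Rightarrow> bool" where
  "ideal_space Y \<longleftrightarrow> banach_lattice le Y \<and> order_ideal L (pts Y)"

text \<open>The norm of an ideal is monotone with respect to the modulus computed inside the ideal. As an ideal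
contains the ambient modulus of each of its elements, the two moduli agree.\<close>

lemma modulus_in_ideal:
  assumes "vector_lattice I le" "order_ideal L I" "x \<in> I"
  shows "modulus (ordset le I) x = md x"
proof -
  interpret I: vector_lattice I le by (rule assms(1))
  have V: "I \<subseteq> V" using assms(2) by (simp add: order_ideal_iff)
  then have "md x \<in> I" using order_ideal_md_iff[OF assms(2), of x] assms(3) by auto
  moreover have "x \<preceq> md x" "- x \<preceq> md x" using V assms(3) by auto
  moreover have "md x \<preceq> z" if "z \<in> I" "x \<preceq> z" "- x \<preceq> z" for z
    using that V assms(3) by (subst md_le_iff) auto
  ultimately show ?thesis
    unfolding modulus_def[of "ordset le I"] using assms(3) by (intro I.join_eqI) auto
qed

text \<open>The form in which ideals are used throughout: domination of the modulus gives membership and the norm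
bound at once.\<close>

lemma ideal_space_norm:
  assumes "ideal_space Y" "x \<in> V" "y \<in> pts Y" "md x \<preceq> md y"
  shows "x \<in> pts Y \<and> nrm Y x \<le> nrm Y y"
proof -
  have Y: "banach_lattice le Y" "order_ideal L (pts Y)" using assms(1) by (auto simp: ideal_space_def)
  have x: "x \<in> pts Y" using order_ideal_mem[OF Y(2) assms(2,3,4)] .
  have "vector_lattice (pts Y) le" using Y(1) by (rule banach_lattice_vector_lattice)
  then have "modulus (ordset le (pts Y)) x = md x" "modulus (ordset le (pts Y)) y = md y"
    using modulus_in_ideal[OF _ Y(2)] x assms(3) by auto
  then show ?thesis using Y(1) x assms(3,4) by (simp add: banach_lattice_def)
qed

lemma ideal_space_norm_nonneg:
  assumes "ideal_space Y" "x \<in> V" "y \<in> pts Y" "0 \<preceq> x" "x \<preceq> y"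
  shows "x \<in> pts Y \<and> nrm Y x \<le> nrm Y y"
proof (rule ideal_space_norm[OF assms(1-3)])
  have "y \<in> V" using assms(1,3) by (auto simp: ideal_space_def order_ideal_iff)
  then have "x \<preceq> md y" using assms(2,5) by (intro ord.le_trans[of x y "md y"]) auto
  then show "md x \<preceq> md y" using assms(2,4) by (simp add: md_of_nonneg)
qed

lemma ideal_space_md:
  assumes "ideal_space Y" "y \<in> pts Y"
  shows "md y \<in> pts Y" "nrm Y (md y) \<le> nrm Y y"
proof -
  have "y \<in> V" using assms by (auto simp: ideal_space_def order_ideal_iff)
  then show "md y \<in> pts Y" "nrm Y (md y) \<le> nrm Y y"
    using ideal_space_norm[OF assms(1), of "md y" y] assms(2) by auto
qed

text \<open>A supremum formed inside an ideal is also a supremum in the whole space: an upper bound \<open>y\<close> from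
outside can be replaced by \<open>s \<curlywedge> y\<close>, which belongs to the ideal because it lies between 0 and \<open>s\<close>.\<close>

lemma sigma_dedekind_sup:
  assumes Y: "ideal_space Y" "sigma_dedekind_complete le Y"
    and b: "\<And>n::nat. b n \<in> V" "\<And>n. 0 \<preceq> b n" "\<And>n. b n \<preceq> c" and c: "c \<in> pts Y"
  shows "\<exists>s. s \<in> pts Y \<and> is_supremum (range b) s"
proof -
  have bY: "b n \<in> pts Y" for n using ideal_space_norm_nonneg[OF Y(1) b(1) c b(2,3)] by simp
  have YV: "pts Y \<subseteq> V" using Y(1) by (auto simp: ideal_space_def order_ideal_iff)
  have "c \<in> Upper (ordset le (pts Y)) (range b)"
    using b(3) c by (auto simp: Upper_def ordset_def)
  then have "Upper (ordset le (pts Y)) (range b) \<noteq> {}" by blast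
  then obtain s where s: "least (ordset le (pts Y)) s (Upper (ordset le (pts Y)) (range b))"
    using Y(2)[unfolded sigma_dedekind_complete_def, rule_format, of "range b"] bY by auto
  have sY: "s \<in> pts Y" and up: "\<And>n. b n \<preceq> s"
    and least: "\<And>y. \<lbrakk>y \<in> pts Y; \<And>n. b n \<preceq> y\<rbrakk> \<Longrightarrow> s \<preceq> y"
    using s bY by (auto simp: least_def Upper_def ordset_def)
  have sV: "s \<in> V" using sY YV by auto
  have "s \<preceq> y" if y: "y \<in> V" "\<And>n. b n \<preceq> y" for y
  proof -
    have m: "b n \<preceq> s \<curlywedge> y" for n using b(1) up y sV by (simp add: le_meet_iff)
    have "0 \<preceq> s \<curlywedge> y" using m[of 0] b(1,2) sV y by (intro ord.le_trans[of 0 "b 0" "s \<curlywedge> y"]) auto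
    then have "s \<curlywedge> y \<in> pts Y"
      using ideal_space_norm_nonneg[OF Y(1) _ sY, of "s \<curlywedge> y"] sV y by (simp add: ord.meet_left)
    then have "s \<preceq> s \<curlywedge> y" using m by (intro least) auto
    then show ?thesis using sV y by (simp add: le_meet_iff)
  qed
  then show ?thesis using sV sY up by (auto simp: is_supremum_def)
qed

text \<open>Countable completeness passes from \<open>X\<^sub>0\<close> and \<open>X\<^sub>1\<close> to increasing sequences in the sum. Cut the sequence
at the \<open>X\<^sub>0\<close>-part of its bound: both \<open>a\<^sub>n \<curlywedge> c\<^sub>0\<close> and \<open>a\<^sub>n - a\<^sub>n \<curlywedge> c\<^sub>0 = (a\<^sub>n - c\<^sub>0)\<^sup>+ \<le> c\<^sub>1\<close> increase and have
suprema, and the supremum of a sum of two increasing sequences is the sum of the suprema.\<close>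

lemma sum_sigma_dedekind_sup:
  assumes Y: "ideal_space Y0" "sigma_dedekind_complete le Y0"
      "ideal_space Y1" "sigma_dedekind_complete le Y1"
    and a: "\<And>n::nat. a n \<in> V" "\<And>n. 0 \<preceq> a n" "\<And>m n. m \<le> n \<Longrightarrow> a m \<preceq> a n"
    and c: "c0 \<in> pts Y0" "c1 \<in> pts Y1" "0 \<preceq> c0" "0 \<preceq> c1" "\<And>n. a n \<preceq> c0 + c1"
  shows "\<exists>s. is_supremum (range a) s"
proof -
  have cV: "c0 \<in> V" "c1 \<in> V" using Y c by (auto simp: ideal_space_def order_ideal_iff)
  define b where "b n = a n \<curlywedge> c0" for n
  define d where "d n = pos (a n - c0)" for n
  have bd: "a n = b n + d n" for n
    unfolding b_def d_def diff_meet[OF a(1) cV(1), symmetric] by simp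
  have V: "b n \<in> V" "d n \<in> V" for n using a cV by (simp_all add: b_def d_def)
  have mono: "b m \<preceq> b n" "d m \<preceq> d n" if "m \<le> n" for m n
  proof -
    show "b m \<preceq> b n" unfolding b_def using a cV that by (intro meet_mono) auto
    have "a m - c0 \<preceq> a n - c0" by (rule le_if_diff_eq[OF a(3)[OF that]]) (use a cV in auto)
    then show "d m \<preceq> d n" unfolding d_def using a cV by (intro pos_mono) auto
  qed
  have "0 \<preceq> b n" "b n \<preceq> c0" for n using a cV c by (auto simp: b_def le_meet_iff ord.meet_right)
  then obtain s0 where s0: "s0 \<in> pts Y0" "is_supremum (range b) s0"
    using sigma_dedekind_sup[OF Y(1,2), of b c0] V c by auto
  have "0 \<preceq> d n" for n using a cV by (simp add: d_def)
  moreover have "d n \<preceq> c1" for n unfolding d_def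
  proof (rule pos_le)
    show "a n - c0 \<preceq> c1" by (rule le_if_diff_eq[OF c(5)]) (use a cV in auto)
  qed (use a cV c in auto)
  ultimately obtain s1 where s1: "s1 \<in> pts Y1" "is_supremum (range d) s1"
    using sigma_dedekind_sup[OF Y(3,4), of d c1] V c by auto
  have s0': "s0 \<in> V" "\<And>n. b n \<preceq> s0" "\<And>y. \<lbrakk>y \<in> V; \<And>n. b n \<preceq> y\<rbrakk> \<Longrightarrow> s0 \<preceq> y"
    using s0(2) by (auto simp: is_supremum_def)
  have s1': "s1 \<in> V" "\<And>n. d n \<preceq> s1" "\<And>y. \<lbrakk>y \<in> V; \<And>n. d n \<preceq> y\<rbrakk> \<Longrightarrow> s1 \<preceq> y"
    using s1(2) by (auto simp: is_supremum_def)
  have "a n \<preceq> s0 + s1" for n unfolding bd using V s0' s1' by (intro add_mono) auto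
  moreover have "s0 + s1 \<preceq> y" if y: "y \<in> V" "\<And>n. a n \<preceq> y" for y
  proof -
    have *: "b m + d n \<preceq> y" for m n
    proof -
      let ?k = "max m n"
      have "b m + d n \<preceq> b ?k + d ?k" using V mono by (intro add_mono) auto
      then have "b m + d n \<preceq> a ?k" by (simp add: bd)
      then show ?thesis using V y a by (intro ord.le_trans[of "b m + d n" "a ?k" y]) auto
    qed
    have "s0 \<preceq> y - d n" for n
    proof (rule s0'(3))
      show "b m \<preceq> y - d n" for m by (rule le_if_diff_eq[OF *[of m n]]) (use V y in auto)
    qed (use V y in auto)
    note ** = this
    have "s1 \<preceq> y - s0"
    proof (rule s1'(3))
      show "d n \<preceq> y - s0" for n by (rule le_if_diff_eq[OF **[of n]]) (use V y s0' in auto)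
    qed (use V y s0' in auto)
    then show ?thesis by (rule le_if_diff_eq) (use y s0' s1' in auto)
  qed
  ultimately have "is_supremum (range a) (s0 + s1)" using s0' s1' by (auto simp: is_supremum_def)
  then show ?thesis by blast
qed

end

section \<open>Splittings and the K-functional\<close>

locale compatible_couple =
  fixes X :: "'a::hausdorff_tvs couple"
  assumes compatible: "compatible_banach_lattices X"
begin

sublocale vector_lattice "pts (sum_space X)" "leq X"
  using compatible by (intro banach_lattice_vector_lattice) (simp add: compatible_banach_lattices_def)

abbreviation le_X (infix "\<preceq>" 50) where "le_X \<equiv> leq X"
abbreviation V :: "'a set" where "V \<equiv> pts (sum_space X)"
abbreviation X0 :: "'a nspace" where "X0 \<equiv> sp0 X"
abbreviation X1 :: "'a nspace" where "X1 \<equiv> sp1 X"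

lemma ideal_space_X0: "ideal_space X0" and ideal_space_X1: "ideal_space X1"
  using compatible by (simp_all add: compatible_banach_lattices_def ideal_space_def sum_ord_def)

lemmas ideal_spaces = ideal_space_X0 ideal_space_X1

lemma X0_mem [simp]: "x \<in> pts X0 \<Longrightarrow> x \<in> V" and X1_mem [simp]: "x \<in> pts X1 \<Longrightarrow> x \<in> V"
  using ideal_spaces by (auto simp: ideal_space_def order_ideal_iff)

lemma V_iff: "f \<in> V \<longleftrightarrow> (\<exists>f0\<in>pts X0. \<exists>f1\<in>pts X1. f = f0 + f1)"
  by (auto simp: sum_space_def)

lemma pos_part_eq: "pos_part X f = pos f" and neg_part_eq: "neg_part X f = neg f"
  by (simp_all add: pos_part_def neg_part_def sum_ord_def)

lemma banach_X0: "banach_space X0" and banach_X1: "banach_space X1"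
  using compatible by (simp_all add: compatible_banach_lattices_def interpolation_couple_def)

end

lemma banach_spaceD:
  assumes "banach_space Y"
  shows "0 \<in> pts Y" "nrm Y 0 = 0"
    and "x \<in> pts Y \<Longrightarrow> 0 \<le> nrm Y x"
    and "\<lbrakk>x \<in> pts Y; nrm Y x = 0\<rbrakk> \<Longrightarrow> x = 0"
    and "x \<in> pts Y \<Longrightarrow> nrm Y (c *\<^sub>R x) = \<bar>c\<bar> * nrm Y x"
    and "\<lbrakk>x \<in> pts Y; y \<in> pts Y\<rbrakk> \<Longrightarrow> nrm Y (x + y) \<le> nrm Y x + nrm Y y"
    and "\<lbrakk>x \<in> pts Y; y \<in> pts Y\<rbrakk> \<Longrightarrow> x + y \<in> pts Y"
    and "\<lbrakk>x \<in> pts Y; y \<in> pts Y\<rbrakk> \<Longrightarrow> x - y \<in> pts Y"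
    and "x \<in> pts Y \<Longrightarrow> c *\<^sub>R x \<in> pts Y"
    and "x \<in> pts Y \<Longrightarrow> - x \<in> pts Y"
  using assms unfolding banach_space_def
  by (auto simp: subspace_0 subspace_add subspace_diff subspace_scale subspace_neg)

context compatible_couple
begin

lemmas [simp] = banach_spaceD(1-3)[OF banach_X0] banach_spaceD(1-3)[OF banach_X1]
  banach_spaceD(7-10)[OF banach_X0] banach_spaceD(7-10)[OF banach_X1]

text \<open>By the Riesz decomposition property, bounding a positive element by \<open>b\<^sub>0 + b\<^sub>1\<close> is as good as splitting
it.\<close>

lemma dominated_split:
  assumes f: "f \<in> V" "0 \<preceq> f" "f \<preceq> b0 + b1"
    and b: "b0 \<in> pts X0" "b1 \<in> pts X1" "0 \<preceq> b0" "0 \<preceq> b1"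
  shows "\<exists>a0\<in>pts X0. \<exists>a1\<in>pts X1. f = a0 + a1 \<and> 0 \<preceq> a0 \<and> 0 \<preceq> a1 \<and>
    nrm X0 a0 \<le> nrm X0 b0 \<and> nrm X1 a1 \<le> nrm X1 b1"
proof -
  have "\<exists>u\<in>V. \<exists>v\<in>V. f = u + v \<and> 0 \<preceq> u \<and> u \<preceq> b0 \<and> 0 \<preceq> v \<and> v \<preceq> b1"
    using f b by (intro riesz_decomposition) auto
  then obtain u v where uv: "u \<in> V" "v \<in> V" "f = u + v" "0 \<preceq> u" "u \<preceq> b0" "0 \<preceq> v" "v \<preceq> b1"
    by blast
  have "u \<in> pts X0 \<and> nrm X0 u \<le> nrm X0 b0"
    by (rule ideal_space_norm_nonneg[OF ideal_space_X0]) (use uv b in auto)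
  moreover have "v \<in> pts X1 \<and> nrm X1 v \<le> nrm X1 b1"
    by (rule ideal_space_norm_nonneg[OF ideal_space_X1]) (use uv b in auto)
  ultimately show ?thesis using uv by blast
qed

text \<open>The K-functional of a positive element may be computed with positive splittings.\<close>

lemma nonneg_split:
  assumes f: "0 \<preceq> f" "f = f0 + f1" and mem: "f0 \<in> pts X0" "f1 \<in> pts X1"
  shows "\<exists>a0\<in>pts X0. \<exists>a1\<in>pts X1. f = a0 + a1 \<and> 0 \<preceq> a0 \<and> 0 \<preceq> a1 \<and>
    nrm X0 a0 \<le> nrm X0 f0 \<and> nrm X1 a1 \<le> nrm X1 f1"
proof -
  have "f \<preceq> md f0 + md f1" unfolding f(2) using mem by (intro add_mono) auto
  then obtain a0 a1 where "a0 \<in> pts X0" "a1 \<in> pts X1" "f = a0 + a1" "0 \<preceq> a0" "0 \<preceq> a1"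
      "nrm X0 a0 \<le> nrm X0 (md f0)" "nrm X1 a1 \<le> nrm X1 (md f1)"
    using dominated_split[of f "md f0" "md f1"] f mem
      ideal_space_md(1)[OF ideal_space_X0] ideal_space_md(1)[OF ideal_space_X1] by auto
  moreover from this have "nrm X0 a0 \<le> nrm X0 f0" "nrm X1 a1 \<le> nrm X1 f1"
    using ideal_space_md(2)[OF ideal_space_X0 mem(1)] ideal_space_md(2)[OF ideal_space_X1 mem(2)]
    by linarith+
  ultimately show ?thesis by blast
qed

lemma nonneg_split_exists:
  assumes "f \<in> V" "0 \<preceq> f"
  obtains a0 a1 where "a0 \<in> pts X0" "a1 \<in> pts X1" "f = a0 + a1" "0 \<preceq> a0" "0 \<preceq> a1"
proof -
  obtain f0 f1 where "f0 \<in> pts X0" "f1 \<in> pts X1" "f = f0 + f1" using assms(1) by (auto simp: V_iff)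
  then show ?thesis using nonneg_split[OF assms(2), of f0 f1] that by auto
qed

lemma Kfun_le_split:
  assumes "f0 \<in> pts X0" "f1 \<in> pts X1" "f = f0 + f1" "0 < t"
  shows "Kfun X f t \<le> nrm X0 f0 + t * nrm X1 f1"
  unfolding Kfun_def
proof (rule cInf_lower)
  show "bdd_below {nrm X0 f0 + t * nrm X1 f1 | f0 f1. f0 \<in> pts X0 \<and> f1 \<in> pts X1 \<and> f = f0 + f1}"
    using assms(4) by (intro bdd_belowI[of _ 0]) auto
qed (use assms in blast)

lemma Kfun_le_dominated:
  assumes "f \<in> V" "0 \<preceq> f" "f \<preceq> b0 + b1" "b0 \<in> pts X0" "b1 \<in> pts X1" "0 \<preceq> b0" "0 \<preceq> b1" "0 < t"
  shows "Kfun X f t \<le> nrm X0 b0 + t * nrm X1 b1"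
proof -
  obtain a0 a1 where a: "a0 \<in> pts X0" "a1 \<in> pts X1" "f = a0 + a1"
      "nrm X0 a0 \<le> nrm X0 b0" "nrm X1 a1 \<le> nrm X1 b1"
    using dominated_split[OF assms(1-7)] by blast
  have "Kfun X f t \<le> nrm X0 a0 + t * nrm X1 a1" using a assms(8) by (intro Kfun_le_split) auto
  also have "\<dots> \<le> nrm X0 b0 + t * nrm X1 b1" using a assms(8) by (intro Groups.add_mono mult_left_mono) auto
  finally show ?thesis .
qed

lemma Kfun_approx:
  assumes "f \<in> V" "0 \<preceq> f" "Kfun X f t < c" "0 < t"
  obtains a0 a1 where "a0 \<in> pts X0" "a1 \<in> pts X1" "f = a0 + a1" "0 \<preceq> a0" "0 \<preceq> a1"
    "nrm X0 a0 + t * nrm X1 a1 < c"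
proof -
  let ?S = "{nrm X0 f0 + t * nrm X1 f1 | f0 f1. f0 \<in> pts X0 \<and> f1 \<in> pts X1 \<and> f = f0 + f1}"
  have "?S \<noteq> {}" using assms(1) V_iff[of f] by blast
  then obtain f0 f1 where f: "f0 \<in> pts X0" "f1 \<in> pts X1" "f = f0 + f1" "nrm X0 f0 + t * nrm X1 f1 < c"
    using cInf_lessD[of ?S c] assms(3) by (auto simp: Kfun_def)
  obtain a0 a1 where a: "a0 \<in> pts X0" "a1 \<in> pts X1" "f = a0 + a1" "0 \<preceq> a0" "0 \<preceq> a1"
      "nrm X0 a0 \<le> nrm X0 f0" "nrm X1 a1 \<le> nrm X1 f1"
    using nonneg_split[OF assms(2) f(3,1,2)] by blast
  have "t * nrm X1 a1 \<le> t * nrm X1 f1" using a(7) assms(4) by simp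
  then show ?thesis using a f(4) that by force
qed

text \<open>The set \<open>G\<close> of pairs \<open>(x\<^sub>0, x\<^sub>1)\<close> that majorise \<open>(\<parallel>g\<^sub>0\<parallel>, \<parallel>g\<^sub>1\<parallel>)\<close> for some splitting of \<open>g\<close> is convex, and the
K-functional records its supporting lines of finite negative slope. If \<open>(a + e, b + e)\<close> were outside
\<open>G\<close>, a line with normal \<open>(s, t)\<close>, \<open>s, t \<ge> 0\<close>, would separate it from \<open>G\<close>. A normal with \<open>s, t > 0\<close>
contradicts the bound on K at \<open>t / s\<close>, and a horizontal or vertical line contradicts it at a very large
or very small argument.\<close>

lemma gagliardo_split:
  assumes g: "g \<in> V" "0 \<preceq> g" and ab: "0 \<le> a" "0 \<le> b" and e: "0 < e"
    and K: "\<And>t. 0 < t \<Longrightarrow> Kfun X g t \<le> a + t * b"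
  shows "\<exists>g0\<in>pts X0. \<exists>g1\<in>pts X1. g = g0 + g1 \<and> 0 \<preceq> g0 \<and> 0 \<preceq> g1 \<and>
    nrm X0 g0 \<le> a + e \<and> nrm X1 g1 \<le> b + e"
proof -
  define G :: "(real \<times> real) set" where
    "G = {x. \<exists>g0\<in>pts X0. \<exists>g1\<in>pts X1. g = g0 + g1 \<and> nrm X0 g0 \<le> fst x \<and> nrm X1 g1 \<le> snd x}"
  have "(a + e, b + e) \<in> G"
  proof (rule ccontr)
    assume no: "(a + e, b + e) \<notin> G"
    have "convex G"
    proof (rule convexI)
      fix x y :: "real \<times> real" and u v :: real
      assume "x \<in> G" "y \<in> G" and uv: "0 \<le> u" "0 \<le> v" "u + v = 1"
      then obtain x0 x1 y0 y1 where x: "x0 \<in> pts X0" "x1 \<in> pts X1" "g = x0 + x1" "nrm X0 x0 \<le> fst x" "nrm X1 x1 \<le> snd x"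
        and y: "y0 \<in> pts X0" "y1 \<in> pts X1" "g = y0 + y1" "nrm X0 y0 \<le> fst y" "nrm X1 y1 \<le> snd y"
        by (auto simp: G_def)
      have "(u *\<^sub>R x0 + v *\<^sub>R y0) + (u *\<^sub>R x1 + v *\<^sub>R y1) = u *\<^sub>R (x0 + x1) + v *\<^sub>R (y0 + y1)"
        by (simp add: scaleR_add_right)
      also have "\<dots> = (u + v) *\<^sub>R g" using x(3) y(3) by (simp add: scaleR_add_left)
      finally have 1: "g = (u *\<^sub>R x0 + v *\<^sub>R y0) + (u *\<^sub>R x1 + v *\<^sub>R y1)" using uv by simp
      have "nrm X0 (u *\<^sub>R x0 + v *\<^sub>R y0) \<le> u * nrm X0 x0 + v * nrm X0 y0"
        using banach_spaceD(6)[OF banach_X0, of "u *\<^sub>R x0" "v *\<^sub>R y0"] x y uv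
        by (simp add: banach_spaceD(5)[OF banach_X0])
      also have "\<dots> \<le> u * fst x + v * fst y" using x y uv by (intro Groups.add_mono mult_left_mono) auto
      finally have 2: "nrm X0 (u *\<^sub>R x0 + v *\<^sub>R y0) \<le> u * fst x + v * fst y" .
      have "nrm X1 (u *\<^sub>R x1 + v *\<^sub>R y1) \<le> u * nrm X1 x1 + v * nrm X1 y1"
        using banach_spaceD(6)[OF banach_X1, of "u *\<^sub>R x1" "v *\<^sub>R y1"] x y uv
        by (simp add: banach_spaceD(5)[OF banach_X1])
      also have "\<dots> \<le> u * snd x + v * snd y" using x y uv by (intro Groups.add_mono mult_left_mono) auto
      finally have 3: "nrm X1 (u *\<^sub>R x1 + v *\<^sub>R y1) \<le> u * snd x + v * snd y" .
      have "\<exists>g0\<in>pts X0. \<exists>g1\<in>pts X1. g = g0 + g1 \<and> nrm X0 g0 \<le> u * fst x + v * fst y \<and> nrm X1 g1 \<le> u * snd x + v * snd y"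
        using 1 2 3 x y by (intro bexI[of _ "u *\<^sub>R x0 + v *\<^sub>R y0"] bexI[of _ "u *\<^sub>R x1 + v *\<^sub>R y1"]) simp_all
      then show "u *\<^sub>R x + v *\<^sub>R y \<in> G" by (simp add: G_def)
    qed
    moreover have "G \<noteq> {}" using g(1) by (auto simp: G_def V_iff)
    ultimately have "\<exists>n c. n \<noteq> 0 \<and> (\<forall>x\<in>{(a + e, b + e)}. inner n x \<le> c) \<and> (\<forall>x\<in>G. c \<le> inner n x)"
      using no by (intro separating_hyperplane_sets) simp_all
    then obtain n c where n: "n \<noteq> 0" "inner n (a + e, b + e) \<le> c" "\<And>x. x \<in> G \<Longrightarrow> c \<le> inner n x"
      by blast
    obtain s t where st: "n = (s, t)" by (cases n)
    have sep: "s * (a + e) + t * (b + e) \<le> s * x0 + t * x1" if "(x0, x1) \<in> G" for x0 x1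
      using n(2) n(3)[OF that] by (simp add: st)
    obtain p0 p1 where p: "(p0, p1) \<in> G" using \<open>G \<noteq> {}\<close> by auto
    have up: "(p0 + d, p1) \<in> G" "(p0, p1 + d) \<in> G" if "0 \<le> d" for d
      using p that by (force simp: G_def)+
    define r where "r = s * p0 + t * p1 - s * (a + e) - t * (b + e)"
    have r0: "0 \<le> r" using sep[OF p] by (simp add: r_def)
    \<comment> \<open>The set \<open>G\<close> is closed under increasing a coordinate, so a negative entry of the normal is impossible.\<close>
    have "0 \<le> s"
    proof (rule ccontr)
      assume s: "\<not> 0 \<le> s"
      define d where "d = (r + 1) / (- s)"
      have d: "0 \<le> d" "s * d = - (r + 1)" using s r0 by (auto simp: d_def field_simps)
      show False using sep[OF up(1)[OF d(1)]] d(2) by (simp add: r_def algebra_simps)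
    qed
    have "0 \<le> t"
    proof (rule ccontr)
      assume t: "\<not> 0 \<le> t"
      define d where "d = (r + 1) / (- t)"
      have d: "0 \<le> d" "t * d = - (r + 1)" using t r0 by (auto simp: d_def field_simps)
      show False using sep[OF up(2)[OF d(1)]] d(2) by (simp add: r_def algebra_simps)
    qed
    have below: "s * (a + e) + t * (b + e) \<le> s * nrm X0 a0 + t * nrm X1 a1"
      if "a0 \<in> pts X0" "a1 \<in> pts X1" "g = a0 + a1" for a0 a1
      using that by (intro sep) (auto simp: G_def)
    show False
    proof (cases "s = 0 \<or> t = 0")
      case False
      then have pos: "0 < s" "0 < t" using \<open>0 \<le> s\<close> \<open>0 \<le> t\<close> by auto
      have "Kfun X g (t/s) < a + (t/s) * b + e" using K[of "t/s"] pos e by simp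
      then obtain a0 a1 where a: "a0 \<in> pts X0" "a1 \<in> pts X1" "g = a0 + a1" "nrm X0 a0 + (t/s) * nrm X1 a1 < a + (t/s) * b + e"
        using Kfun_approx[OF g] pos by (metis divide_pos_pos)
      have "s * nrm X0 a0 + t * nrm X1 a1 < s * (a + e) + t * b"
        using mult_strict_left_mono[OF a(4) pos(1)] pos by (simp add: algebra_simps)
      moreover have "0 < t * e" using pos e by simp
      ultimately show False using below[OF a(1-3)] by (simp add: algebra_simps)
    next
      case True
      then consider "s = 0" "0 < t" | "0 < s" "t = 0" using n(1) st \<open>0 \<le> s\<close> \<open>0 \<le> t\<close> by (auto simp: zero_prod_def)
      then show False
      proof cases
        case 1
        \<comment> \<open>Now \<open>\<parallel>a\<^sub>1\<parallel> \<ge> b + e\<close> for all splittings; the excess \<open>\<tau> e = a + 1\<close> exhausts the bound \<open>a + \<tau> b + 1\<close>.\<close>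
        define \<tau> where "\<tau> = (a + 1) / e"
        have \<tau>: "0 < \<tau>" "\<tau> * e = a + 1" using ab e by (auto simp: \<tau>_def)
        have "Kfun X g \<tau> < a + \<tau> * b + 1" using K[OF \<tau>(1)] by simp
        then obtain a0 a1 where a: "a0 \<in> pts X0" "a1 \<in> pts X1" "g = a0 + a1" "nrm X0 a0 + \<tau> * nrm X1 a1 < a + \<tau> * b + 1"
          using Kfun_approx[OF g _ \<tau>(1)] by metis
        have "b + e \<le> nrm X1 a1" using below[OF a(1-3)] 1 by simp
        then have "\<tau> * (b + e) \<le> \<tau> * nrm X1 a1" using \<tau> by simp
        moreover have "0 \<le> nrm X0 a0" using a by simp
        ultimately show False using a(4) \<tau>(2) by (simp add: algebra_simps)
      next
        case 2
        \<comment> \<open>Now \<open>\<parallel>a\<^sub>0\<parallel> \<ge> a + e\<close> for all splittings, while \<open>\<tau> b \<le> e / 2\<close>.\<close>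
        define \<tau> where "\<tau> = e / (2 * (b + 1))"
        have \<tau>: "0 < \<tau>" "\<tau> * b \<le> e / 2" using ab e by (auto simp: \<tau>_def field_simps)
        have "Kfun X g \<tau> < a + \<tau> * b + e / 2" using K[OF \<tau>(1)] e by simp
        then obtain a0 a1 where a: "a0 \<in> pts X0" "a1 \<in> pts X1" "g = a0 + a1" "nrm X0 a0 + \<tau> * nrm X1 a1 < a + \<tau> * b + e / 2"
          using Kfun_approx[OF g _ \<tau>(1)] by metis
        have "a + e \<le> nrm X0 a0" using below[OF a(1-3)] 2 by simp
        moreover have "0 \<le> \<tau> * nrm X1 a1" using a \<tau> by simp
        ultimately show False using a(4) \<tau>(2) by linarith
      qed
    qed
  qed
  then obtain f0 f1 where f: "f0 \<in> pts X0" "f1 \<in> pts X1" "g = f0 + f1" "nrm X0 f0 \<le> a + e" "nrm X1 f1 \<le> b + e"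
    by (auto simp: G_def)
  obtain a0 a1 where "a0 \<in> pts X0" "a1 \<in> pts X1" "g = a0 + a1" "0 \<preceq> a0" "0 \<preceq> a1"
      "nrm X0 a0 \<le> nrm X0 f0" "nrm X1 a1 \<le> nrm X1 f1"
    using nonneg_split[OF g(2) f(3,1,2)] by blast
  moreover from this have "nrm X0 a0 \<le> a + e" "nrm X1 a1 \<le> b + e" using f(4,5) by linarith+
  ultimately show ?thesis by blast
qed

end

section \<open>K-monotonicity and Gagliardo-Peetre operators\<close>

text \<open>The norms of nonlinear operators are least bounds, so they are meaningful only once the least bound is
known to be attained. Closedness is stated through approximation from above.\<close>

lemma Least_real_closed:
  fixes P :: "real \<Rightarrow> bool"
  assumes "P c0" "\<And>c. P c \<Longrightarrow> 0 \<le> c"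
    and closed: "\<And>c. \<lbrakk>0 \<le> c; \<And>e. 0 < e \<Longrightarrow> \<exists>c'. P c' \<and> c' < c + e\<rbrakk> \<Longrightarrow> P c"
  shows "P (Least P)" "P c \<Longrightarrow> Least P \<le> c"
proof -
  define s where "s = Inf (Collect P)"
  have bdd: "bdd_below (Collect P)" using assms(2) by (intro bdd_belowI[of _ 0]) auto
  have low: "s \<le> d" if "P d" for d unfolding s_def using that bdd by (intro cInf_lower) auto
  have "P s"
  proof (rule closed)
    show "0 \<le> s" unfolding s_def using assms(1,2) by (intro cInf_greatest) auto
    show "\<exists>c'. P c' \<and> c' < s + e" if "0 < e" for e
      using cInf_lessD[of "Collect P" "s + e"] assms(1) that by (auto simp: s_def)
  qed
  then have "Least P = s" using low by (intro Least_equality) auto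
  then show "P (Least P)" "P c \<Longrightarrow> Least P \<le> c" using \<open>P s\<close> low by auto
qed

context compatible_couple
begin

text \<open>The bound \<open>C\<close> for a positive Gagliardo-Peetre operator is a condition on each point \<open>f\<close> and its value \<open>h\<close>
separately; this is that condition.\<close>

definition GP_pair :: "real \<Rightarrow> 'a \<Rightarrow> 'a \<Rightarrow> bool" where
  "GP_pair C f h \<longleftrightarrow>
     (\<forall>f0\<in>pts X0. \<forall>f1\<in>pts X1. \<forall>e>0. f = f0 + f1 \<longrightarrow>
        (\<exists>g0\<in>pts X0. \<exists>g1\<in>pts X1. h = g0 + g1 \<and>
           nrm X0 (pos g0) \<le> C * nrm X0 (pos f0) + e \<and>
           nrm X0 (neg g0) \<le> C * nrm X0 (neg f0) + e \<and>
           nrm X1 (pos g1) \<le> C * nrm X1 (pos f1) + e \<and>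
           nrm X1 (neg g1) \<le> C * nrm X1 (neg f1) + e))"

lemma GP_bound_iff: "GP_bound X D S C \<longleftrightarrow> 0 \<le> C \<and> (\<forall>f\<in>D. GP_pair C f (S f))"
  by (simp add: GP_bound_def GP_pair_def pos_part_eq neg_part_eq)

lemma GP_pairI:
  assumes "\<And>f0 f1 e. \<lbrakk>f0 \<in> pts X0; f1 \<in> pts X1; f = f0 + f1; 0 < e\<rbrakk> \<Longrightarrow>
    \<exists>g0\<in>pts X0. \<exists>g1\<in>pts X1. h = g0 + g1 \<and>
      nrm X0 (pos g0) \<le> C * nrm X0 (pos f0) + e \<and> nrm X0 (neg g0) \<le> C * nrm X0 (neg f0) + e \<and>
      nrm X1 (pos g1) \<le> C * nrm X1 (pos f1) + e \<and> nrm X1 (neg g1) \<le> C * nrm X1 (neg f1) + e"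
  shows "GP_pair C f h"
  using assms unfolding GP_pair_def by blast

lemma GP_pairE:
  assumes "GP_pair C f h" "f0 \<in> pts X0" "f1 \<in> pts X1" "f = f0 + f1" "0 < e"
  obtains g0 g1 where "g0 \<in> pts X0" "g1 \<in> pts X1" "h = g0 + g1"
    "nrm X0 (pos g0) \<le> C * nrm X0 (pos f0) + e" "nrm X0 (neg g0) \<le> C * nrm X0 (neg f0) + e"
    "nrm X1 (pos g1) \<le> C * nrm X1 (pos f1) + e" "nrm X1 (neg g1) \<le> C * nrm X1 (neg f1) + e"
  using assms unfolding GP_pair_def by blast

lemma ideal_space_pos:
  assumes "ideal_space Y" "y \<in> pts Y"
  shows "pos y \<in> pts Y" "neg y \<in> pts Y"
proof -
  have V: "y \<in> V" using assms by (auto simp: ideal_space_def order_ideal_iff)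
  show "pos y \<in> pts Y"
    using ideal_space_norm[OF assms(1) _ assms(2), of "pos y"] V by (simp add: md_of_nonneg pos_le_md)
  show "neg y \<in> pts Y"
    using ideal_space_norm[OF assms(1) _ assms(2), of "neg y"] V by (simp add: md_of_nonneg neg_le_md)
qed

lemmas [simp] = ideal_space_pos[OF ideal_space_X0] ideal_space_pos[OF ideal_space_X1]

lemma GP_pair_mono: assumes "GP_pair C f h" "C \<le> C'" shows "GP_pair C' f h"
proof (rule GP_pairI)
  fix f0 f1 e assume f: "f0 \<in> pts X0" "f1 \<in> pts X1" "f = f0 + f1" "0 < (e::real)"
  have *: "C * nrm X0 (pos f0) \<le> C' * nrm X0 (pos f0)" "C * nrm X0 (neg f0) \<le> C' * nrm X0 (neg f0)"
    "C * nrm X1 (pos f1) \<le> C' * nrm X1 (pos f1)" "C * nrm X1 (neg f1) \<le> C' * nrm X1 (neg f1)"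
    using f assms(2) by (simp_all add: mult_right_mono)
  obtain g0 g1 where g: "g0 \<in> pts X0" "g1 \<in> pts X1" "h = g0 + g1"
    "nrm X0 (pos g0) \<le> C * nrm X0 (pos f0) + e" "nrm X0 (neg g0) \<le> C * nrm X0 (neg f0) + e"
    "nrm X1 (pos g1) \<le> C * nrm X1 (pos f1) + e" "nrm X1 (neg g1) \<le> C * nrm X1 (neg f1) + e"
    using GP_pairE[OF assms(1) f] by blast
  show "\<exists>g0\<in>pts X0. \<exists>g1\<in>pts X1. h = g0 + g1 \<and>
      nrm X0 (pos g0) \<le> C' * nrm X0 (pos f0) + e \<and> nrm X0 (neg g0) \<le> C' * nrm X0 (neg f0) + e \<and>
      nrm X1 (pos g1) \<le> C' * nrm X1 (pos f1) + e \<and> nrm X1 (neg g1) \<le> C' * nrm X1 (neg f1) + e"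
    by (intro bexI[of _ g0] bexI[of _ g1] conjI g) (use g * in linarith)+
qed

text \<open>The slack \<open>e\<close> absorbs a small enlargement of the constant, because the four norms on the right are
fixed numbers once the splitting of \<open>f\<close> is given. This is why the least constant is attained.\<close>

lemma GP_pair_closed:
  assumes "\<And>d. 0 < d \<Longrightarrow> GP_pair (C + d) f h"
  shows "GP_pair C f h"
proof (rule GP_pairI)
  fix f0 f1 e assume f: "f0 \<in> pts X0" "f1 \<in> pts X1" "f = f0 + f1" "0 < (e::real)"
  define M where "M = nrm X0 (pos f0) + nrm X0 (neg f0) + nrm X1 (pos f1) + nrm X1 (neg f1) + 1"
  define d where "d = e / (2 * M)"
  have nn: "0 \<le> nrm X0 (pos f0)" "0 \<le> nrm X0 (neg f0)" "0 \<le> nrm X1 (pos f1)" "0 \<le> nrm X1 (neg f1)"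
    using f by simp_all
  then have M: "0 < M" by (simp add: M_def)
  have d: "0 < d" "d * M = e / 2" using M f by (simp_all add: d_def)
  have "(C + d) * x + e / 2 \<le> C * x + e" if "x \<le> M" for x
  proof -
    have "d * x \<le> d * M" using that d(1) by simp
    then show ?thesis unfolding distrib_right using d(2) by linarith
  qed
  then have *: "(C + d) * nrm X0 (pos f0) + e / 2 \<le> C * nrm X0 (pos f0) + e"
    "(C + d) * nrm X0 (neg f0) + e / 2 \<le> C * nrm X0 (neg f0) + e"
    "(C + d) * nrm X1 (pos f1) + e / 2 \<le> C * nrm X1 (pos f1) + e"
    "(C + d) * nrm X1 (neg f1) + e / 2 \<le> C * nrm X1 (neg f1) + e"
    using nn by (simp_all add: M_def)
  have e2: "0 < e / 2" using f by simp
  obtain g0 g1 where g: "g0 \<in> pts X0" "g1 \<in> pts X1" "h = g0 + g1"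
    "nrm X0 (pos g0) \<le> (C + d) * nrm X0 (pos f0) + e / 2" "nrm X0 (neg g0) \<le> (C + d) * nrm X0 (neg f0) + e / 2"
    "nrm X1 (pos g1) \<le> (C + d) * nrm X1 (pos f1) + e / 2" "nrm X1 (neg g1) \<le> (C + d) * nrm X1 (neg f1) + e / 2"
    using GP_pairE[OF assms[OF d(1)] f(1-3) e2] by blast
  show "\<exists>g0\<in>pts X0. \<exists>g1\<in>pts X1. h = g0 + g1 \<and>
      nrm X0 (pos g0) \<le> C * nrm X0 (pos f0) + e \<and> nrm X0 (neg g0) \<le> C * nrm X0 (neg f0) + e \<and>
      nrm X1 (pos g1) \<le> C * nrm X1 (pos f1) + e \<and> nrm X1 (neg g1) \<le> C * nrm X1 (neg f1) + e"
    by (intro bexI[of _ g0] bexI[of _ g1] conjI g) (use g * in linarith)+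
qed

lemma GP_norm:
  assumes "positive_GP X D S"
  shows "GP_bound X D S (GP_norm X D S)" "GP_bound X D S C \<Longrightarrow> GP_norm X D S \<le> C"
proof -
  obtain C0 where C0: "GP_bound X D S C0" using assms by (auto simp: positive_GP_def)
  have closed: "GP_bound X D S c"
    if c: "0 \<le> c" "\<And>e. 0 < e \<Longrightarrow> \<exists>c'. GP_bound X D S c' \<and> c' < c + e" for c
    unfolding GP_bound_iff
  proof (intro conjI ballI)
    fix f assume f: "f \<in> D"
    show "GP_pair c f (S f)"
    proof (rule GP_pair_closed)
      fix d :: real assume "0 < d"
      then obtain c' where "GP_bound X D S c'" "c' < c + d" using c(2) by blast
      then show "GP_pair (c + d) f (S f)"
        using f by (intro GP_pair_mono[of c' f "S f" "c + d"]) (auto simp: GP_bound_iff)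
    qed
  qed (use c in simp)
  show "GP_bound X D S (GP_norm X D S)" "GP_bound X D S C \<Longrightarrow> GP_norm X D S \<le> C"
    unfolding GP_norm_def
    using Least_real_closed[of "GP_bound X D S", OF C0 _ closed] by (auto simp: GP_bound_iff)
qed

lemma GP_pair_uminus: assumes "GP_pair C f h" shows "GP_pair C (- f) (- h)"
proof (rule GP_pairI)
  fix f0 f1 e assume f: "f0 \<in> pts X0" "f1 \<in> pts X1" "- f = f0 + f1" "0 < (e::real)"
  have f': "- f0 \<in> pts X0" "- f1 \<in> pts X1" using f by simp_all
  have "- (- f) = - (f0 + f1)" using f(3) by (rule arg_cong)
  then have "f = - f0 + - f1" by simp
  then obtain g0 g1 where g: "g0 \<in> pts X0" "g1 \<in> pts X1" "h = g0 + g1"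
    "nrm X0 (pos g0) \<le> C * nrm X0 (pos (- f0)) + e" "nrm X0 (neg g0) \<le> C * nrm X0 (neg (- f0)) + e"
    "nrm X1 (pos g1) \<le> C * nrm X1 (pos (- f1)) + e" "nrm X1 (neg g1) \<le> C * nrm X1 (neg (- f1)) + e"
    using GP_pairE[OF assms f' _ f(4)] by blast
  show "\<exists>g0\<in>pts X0. \<exists>g1\<in>pts X1. - h = g0 + g1 \<and>
      nrm X0 (pos g0) \<le> C * nrm X0 (pos f0) + e \<and> nrm X0 (neg g0) \<le> C * nrm X0 (neg f0) + e \<and>
      nrm X1 (pos g1) \<le> C * nrm X1 (pos f1) + e \<and> nrm X1 (neg g1) \<le> C * nrm X1 (neg f1) + e"
    using g by (intro bexI[of _ "- g0"] bexI[of _ "- g1"]) simp_all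
qed

text \<open>Positive splittings of \<open>h\<^sup>+\<close> and \<open>h\<^sup>-\<close>, chosen independently, combine to a splitting of \<open>h\<close> whose
parts have positive and negative parts under control, since \<open>(p - n)\<^sup>+ \<le> p\<close> for \<open>p, n \<ge> 0\<close>.\<close>

lemma signed_split:
  assumes h: "h \<in> V" "pos h = p0 + p1" "neg h = n0 + n1"
    and mem: "p0 \<in> pts X0" "p1 \<in> pts X1" "n0 \<in> pts X0" "n1 \<in> pts X1"
    and nonneg: "0 \<preceq> p0" "0 \<preceq> p1" "0 \<preceq> n0" "0 \<preceq> n1"
  shows "h = (p0 - n0) + (p1 - n1)"
    and "nrm X0 (pos (p0 - n0)) \<le> nrm X0 p0" "nrm X0 (neg (p0 - n0)) \<le> nrm X0 n0"
    and "nrm X1 (pos (p1 - n1)) \<le> nrm X1 p1" "nrm X1 (neg (p1 - n1)) \<le> nrm X1 n1"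
proof -
  have "h = pos h - neg h" using pos_minus_neg[OF h(1)] by simp
  also have "\<dots> = (p0 + p1) - (n0 + n1)" by (simp only: h)
  also have "\<dots> = (p0 - n0) + (p1 - n1)" by simp
  finally show "h = (p0 - n0) + (p1 - n1)" .
  have *: "pos (a - b) \<preceq> a" if "a \<in> V" "b \<in> V" "0 \<preceq> a" "0 \<preceq> b" for a b
  proof (rule pos_le)
    show "a - b \<preceq> a" using that(4) by (rule le_if_diff_eq) (use that in auto)
  qed (use that in auto)
  show "nrm X0 (pos (p0 - n0)) \<le> nrm X0 p0" "nrm X0 (neg (p0 - n0)) \<le> nrm X0 n0"
    using ideal_space_norm_nonneg[OF ideal_space_X0, of "pos (p0 - n0)" p0]
      ideal_space_norm_nonneg[OF ideal_space_X0, of "neg (p0 - n0)" n0]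
      *[of p0 n0] *[of n0 p0] mem nonneg by auto
  show "nrm X1 (pos (p1 - n1)) \<le> nrm X1 p1" "nrm X1 (neg (p1 - n1)) \<le> nrm X1 n1"
    using ideal_space_norm_nonneg[OF ideal_space_X1, of "pos (p1 - n1)" p1]
      ideal_space_norm_nonneg[OF ideal_space_X1, of "neg (p1 - n1)" n1]
      *[of p1 n1] *[of n1 p1] mem nonneg by auto
qed

text \<open>Only the splitting of \<open>f\<^sup>+\<close> has to be nearly optimal; that of \<open>f\<^sup>-\<close> is arbitrary. The resulting
splitting of \<open>f\<close> is mapped to one of \<open>h\<close>, and \<open>h\<^sup>+ \<le> g\<^sub>0\<^sup>+ + g\<^sub>1\<^sup>+\<close>.\<close>

lemma GP_pair_Kfun_pos:
  assumes f: "f \<in> V" and h: "h \<in> V" and GP: "GP_pair 1 f h" and t: "0 < t"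
  shows "Kfun X (pos h) t \<le> Kfun X (pos f) t"
proof (rule field_le_epsilon)
  fix e :: real assume e: "0 < e"
  define d where "d = e / (2 * (1 + t))"
  have d: "0 < d" "(1 + t) * d = e / 2" using e t by (auto simp: d_def field_simps)
  have pf: "pos f \<in> V" "0 \<preceq> pos f" and nf: "neg f \<in> V" "0 \<preceq> neg f" using f by simp_all
  obtain p0 p1 where p: "p0 \<in> pts X0" "p1 \<in> pts X1" "pos f = p0 + p1" "0 \<preceq> p0" "0 \<preceq> p1"
      "nrm X0 p0 + t * nrm X1 p1 < Kfun X (pos f) t + e / 2"
    using Kfun_approx[OF pf _ t, of "Kfun X (pos f) t + e / 2"] e by auto
  obtain n0 n1 where n: "n0 \<in> pts X0" "n1 \<in> pts X1" "neg f = n0 + n1" "0 \<preceq> n0" "0 \<preceq> n1"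
    using nonneg_split_exists[OF nf] by blast
  note s = signed_split[OF f p(3) n(3) p(1,2) n(1,2) p(4,5) n(4,5)]
  have mem: "p0 - n0 \<in> pts X0" "p1 - n1 \<in> pts X1" using p n by simp_all
  obtain g0 g1 where g: "g0 \<in> pts X0" "g1 \<in> pts X1" "h = g0 + g1"
      "nrm X0 (pos g0) \<le> 1 * nrm X0 (pos (p0 - n0)) + d" "nrm X1 (pos g1) \<le> 1 * nrm X1 (pos (p1 - n1)) + d"
    using GP_pairE[OF GP mem s(1) d(1)] by blast
  have "pos h \<preceq> pos g0 + pos g1" unfolding g(3) using g by (intro pos_add_le) auto
  then have "Kfun X (pos h) t \<le> nrm X0 (pos g0) + t * nrm X1 (pos g1)"
    using h g t by (intro Kfun_le_dominated) auto
  also have "\<dots> \<le> (nrm X0 p0 + d) + t * (nrm X1 p1 + d)"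
    using g s t by (intro Groups.add_mono mult_left_mono) auto
  also have "\<dots> = (nrm X0 p0 + t * nrm X1 p1) + (1 + t) * d" by (simp add: algebra_simps)
  also have "\<dots> \<le> Kfun X (pos f) t + e" using p(6) d(2) by linarith
  finally show "Kfun X (pos h) t \<le> Kfun X (pos f) t + e" .
qed

lemma GP_pair_imp_K_dominated:
  assumes "f \<in> V" "h \<in> V" "GP_pair 1 f h" shows "K_dominated X h f"
  using GP_pair_Kfun_pos[OF assms] GP_pair_Kfun_pos[OF _ _ GP_pair_uminus[OF assms(3)]] assms(1,2)
  by (simp add: K_dominated_def pos_part_eq neg_part_eq)

text \<open>A splitting of \<open>f\<close> bounds \<open>K(f\<^sup>+, t)\<close>, hence \<open>K(h\<^sup>+, t)\<close>, by \<open>\<parallel>f\<^sub>0\<^sup>+\<parallel> + t \<parallel>f\<^sub>1\<^sup>+\<parallel>\<close> for all \<open>t\<close>, so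
\<open>gagliardo_split\<close> splits \<open>h\<^sup>+\<close> accordingly up to \<open>e\<close>. The same is done for the negative parts, and the two
splittings are subtracted.\<close>

lemma K_dominated_imp_GP_pair:
  assumes f: "f \<in> V" and h: "h \<in> V" and K: "K_dominated X h f"
  shows "GP_pair 1 f h"
proof (rule GP_pairI)
  fix f0 f1 e assume f': "f0 \<in> pts X0" "f1 \<in> pts X1" "f = f0 + f1" "0 < (e::real)"
  have 1: "Kfun X (pos h) t \<le> nrm X0 (pos f0) + t * nrm X1 (pos f1)" if "0 < t" for t
  proof -
    have "pos f \<preceq> pos f0 + pos f1" unfolding f'(3) using f' by (intro pos_add_le) auto
    then have "Kfun X (pos f) t \<le> nrm X0 (pos f0) + t * nrm X1 (pos f1)"
      using f f' that by (intro Kfun_le_dominated) auto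
    moreover have "Kfun X (pos h) t \<le> Kfun X (pos f) t"
      using K that by (simp add: K_dominated_def pos_part_eq)
    ultimately show ?thesis by linarith
  qed
  have 2: "Kfun X (neg h) t \<le> nrm X0 (neg f0) + t * nrm X1 (neg f1)" if "0 < t" for t
  proof -
    have "pos (- f0 + - f1) \<preceq> neg f0 + neg f1" using f' by (intro pos_add_le) auto
    then have "neg f \<preceq> neg f0 + neg f1" by (simp add: f'(3))
    then have "Kfun X (neg f) t \<le> nrm X0 (neg f0) + t * nrm X1 (neg f1)"
      using f f' that by (intro Kfun_le_dominated) auto
    moreover have "Kfun X (neg h) t \<le> Kfun X (neg f) t"
      using K that by (simp add: K_dominated_def neg_part_eq)
    ultimately show ?thesis by linarith
  qed
  obtain p0 p1 where p: "p0 \<in> pts X0" "p1 \<in> pts X1" "pos h = p0 + p1" "0 \<preceq> p0" "0 \<preceq> p1"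
      "nrm X0 p0 \<le> nrm X0 (pos f0) + e" "nrm X1 p1 \<le> nrm X1 (pos f1) + e"
    using gagliardo_split[OF _ _ _ _ f'(4) 1] h f' by auto
  obtain n0 n1 where n: "n0 \<in> pts X0" "n1 \<in> pts X1" "neg h = n0 + n1" "0 \<preceq> n0" "0 \<preceq> n1"
      "nrm X0 n0 \<le> nrm X0 (neg f0) + e" "nrm X1 n1 \<le> nrm X1 (neg f1) + e"
    using gagliardo_split[OF _ _ _ _ f'(4) 2] h f' by auto
  note s = signed_split[OF h p(3) n(3) p(1,2) n(1,2) p(4,5) n(4,5)]
  show "\<exists>g0\<in>pts X0. \<exists>g1\<in>pts X1. h = g0 + g1 \<and>
      nrm X0 (pos g0) \<le> 1 * nrm X0 (pos f0) + e \<and> nrm X0 (neg g0) \<le> 1 * nrm X0 (neg f0) + e \<and>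
      nrm X1 (pos g1) \<le> 1 * nrm X1 (pos f1) + e \<and> nrm X1 (neg g1) \<le> 1 * nrm X1 (neg f1) + e"
    using s p(1,2,6,7) n(1,2,6,7)
    by (intro bexI[of _ "p0 - n0"] bexI[of _ "p1 - n1"] conjI) (simp_all del: diff_add_eq)
qed

lemma GP_pair_scaleR:
  assumes GP: "GP_pair c f h" and c: "0 < c"
  shows "GP_pair 1 f ((1/c) *\<^sub>R h)"
proof (rule GP_pairI)
  fix f0 f1 e assume f: "f0 \<in> pts X0" "f1 \<in> pts X1" "f = f0 + f1" "0 < (e::real)"
  have ce: "0 < c * e" using c f by simp
  obtain g0 g1 where g: "g0 \<in> pts X0" "g1 \<in> pts X1" "h = g0 + g1"
    "nrm X0 (pos g0) \<le> c * nrm X0 (pos f0) + c * e" "nrm X0 (neg g0) \<le> c * nrm X0 (neg f0) + c * e"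
    "nrm X1 (pos g1) \<le> c * nrm X1 (pos f1) + c * e" "nrm X1 (neg g1) \<le> c * nrm X1 (neg f1) + c * e"
    using GP_pairE[OF GP f(1-3) ce] by blast
  have s: "nrm Y (pos ((1/c) *\<^sub>R g)) = (1/c) * nrm Y (pos g) \<and> nrm Y (neg ((1/c) *\<^sub>R g)) = (1/c) * nrm Y (neg g)"
    if "Y = X0 \<or> Y = X1" "g \<in> pts Y" for Y g
  proof -
    have "g \<in> V" using that by auto
    then have "pos ((1/c) *\<^sub>R g) = (1/c) *\<^sub>R pos g" "neg ((1/c) *\<^sub>R g) = (1/c) *\<^sub>R neg g"
      using pos_scaleR[of g "1/c"] pos_scaleR[of "- g" "1/c"] c by simp_all
    then show ?thesis
      using that c banach_spaceD(5)[OF banach_X0] banach_spaceD(5)[OF banach_X1] by auto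
  qed
  have d: "x \<le> c * y + c * e \<Longrightarrow> (1/c) * x \<le> 1 * y + e" for x y
    using c by (simp add: field_simps)
  show "\<exists>g0\<in>pts X0. \<exists>g1\<in>pts X1. (1/c) *\<^sub>R h = g0 + g1 \<and>
      nrm X0 (pos g0) \<le> 1 * nrm X0 (pos f0) + e \<and> nrm X0 (neg g0) \<le> 1 * nrm X0 (neg f0) + e \<and>
      nrm X1 (pos g1) \<le> 1 * nrm X1 (pos f1) + e \<and> nrm X1 (neg g1) \<le> 1 * nrm X1 (neg f1) + e"
  proof (rule bexI[of _ "(1/c) *\<^sub>R g0"], rule bexI[of _ "(1/c) *\<^sub>R g1"], intro conjI)
    show "(1/c) *\<^sub>R h = (1/c) *\<^sub>R g0 + (1/c) *\<^sub>R g1" by (simp add: g(3) scaleR_add_right)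
  qed (use g s[of X0 g0] s[of X1 g1] d in \<open>simp_all del: mult_1\<close>)
qed

end

locale intermediate = compatible_couple X for X :: "'a::hausdorff_tvs couple" +
  fixes Z :: "'a nspace"
  assumes intermediate: "intermediate_space X Z"
begin

lemma banach_Z: "banach_space Z"
  using intermediate by (simp add: intermediate_space_def)

lemmas [simp] = banach_spaceD(1-3)[OF banach_Z] banach_spaceD(7-10)[OF banach_Z]

lemma Z_mem [simp]: "f \<in> pts Z \<Longrightarrow> f \<in> V"
  using intermediate by (auto simp: intermediate_space_def cont_subspace_def)

text \<open>The value \<open>S f\<close> is rescaled by a constant \<open>c\<close> slightly above the norm of \<open>S\<close>, as the norm itself may be
0; afterwards \<open>c\<close> tends to the norm.\<close>

lemma K_monotone_imp_GP:
  assumes K: "exact_partially_K_monotone X Z"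
  shows "exact_interpolation_GP X Z"
  unfolding exact_interpolation_GP_def
proof (intro allI impI ballI)
  fix D S f assume S: "positive_GP X D S" and f: "f \<in> pts Z \<inter> D"
  let ?C = "GP_norm X D S"
  have h: "S f \<in> V" using S f by (auto simp: positive_GP_def operator_on_def)
  have GP: "0 \<le> ?C" "GP_pair ?C f (S f)" using GP_norm(1)[OF S] f by (auto simp: GP_bound_iff)
  have *: "S f \<in> pts Z \<and> nrm Z (S f) \<le> c * nrm Z f" if c: "?C \<le> c" "0 < c" for c
  proof -
    have "GP_pair 1 f ((1/c) *\<^sub>R S f)" by (intro GP_pair_scaleR GP_pair_mono[OF GP(2)] c)
    then have "K_dominated X ((1/c) *\<^sub>R S f) f"
      using f h by (intro GP_pair_imp_K_dominated) auto
    then have k: "(1/c) *\<^sub>R S f \<in> pts Z" "nrm Z ((1/c) *\<^sub>R S f) \<le> nrm Z f"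
      using K f h unfolding exact_partially_K_monotone_def by auto
    have "c *\<^sub>R (1/c) *\<^sub>R S f \<in> pts Z" using k(1) banach_spaceD(9)[OF banach_Z] by blast
    then have m: "S f \<in> pts Z" using c(2) by simp
    have "(1/c) * nrm Z (S f) \<le> nrm Z f"
      using banach_spaceD(5)[OF banach_Z m, of "1/c"] c(2) k(2) by simp
    then show ?thesis using c(2) m by (simp add: field_simps)
  qed
  have "nrm Z (S f) \<le> ?C * nrm Z f"
  proof (rule field_le_epsilon)
    fix e :: real assume e: "0 < e"
    define d where "d = e / (nrm Z f + 1)"
    have nn: "0 \<le> nrm Z f" using f by simp
    then have d: "0 < d" "d * nrm Z f \<le> e" using e by (auto simp: d_def field_simps)
    have "nrm Z (S f) \<le> (?C + d) * nrm Z f" using *[of "?C + d"] GP d by simp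
    then show "nrm Z (S f) \<le> ?C * nrm Z f + e" using d(2) by (simp add: distrib_right)
  qed
  moreover have "S f \<in> pts Z" using *[of "?C + 1"] GP by simp
  ultimately show "S f \<in> pts Z \<and> nrm Z (S f) \<le> ?C * nrm Z f" by simp
qed

text \<open>Every Gagliardo-Peetre pair is an operator, namely the one with domain \<open>{f}\<close>.\<close>

lemma exact_GP_pair:
  assumes "exact_interpolation_GP X Z" and f: "f \<in> pts Z" and h: "h \<in> V"
    and C: "0 \<le> C" "GP_pair C f h"
  shows "h \<in> pts Z \<and> nrm Z h \<le> C * nrm Z f"
proof -
  have b: "GP_bound X {f} (\<lambda>_. h) C" using C by (simp add: GP_bound_iff)
  then have S: "positive_GP X {f} (\<lambda>_. h)" using f h by (auto simp: positive_GP_def operator_on_def)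
  have "h \<in> pts Z \<and> nrm Z h \<le> GP_norm X {f} (\<lambda>_. h) * nrm Z f"
    using assms(1) S f unfolding exact_interpolation_GP_def by blast
  moreover have "GP_norm X {f} (\<lambda>_. h) * nrm Z f \<le> C * nrm Z f"
    using GP_norm(2)[OF S b] f by (intro mult_right_mono) auto
  ultimately show ?thesis by linarith
qed

lemma GP_imp_K_monotone:
  assumes "exact_interpolation_GP X Z"
  shows "exact_partially_K_monotone X Z"
  unfolding exact_partially_K_monotone_def
proof (intro ballI impI)
  fix f g assume f: "f \<in> pts Z" and g: "g \<in> V" and "K_dominated X g f"
  then have "GP_pair 1 f g" by (intro K_dominated_imp_GP_pair) auto
  then show "g \<in> pts Z \<and> nrm Z g \<le> nrm Z f"
    using exact_GP_pair[OF assms f g, of 1] by simp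
qed

end

section \<open>Order preserving Lipschitz operators\<close>

lemma lip_ineq_closed:
  assumes Y: "banach_space Y" and ap: "\<And>e. 0 < e \<Longrightarrow> \<exists>c'. lip_ineq Y S c' f h \<and> c' < c + e"
  shows "lip_ineq Y S c f h"
  unfolding lip_ineq_def
proof (intro impI conjI)
  assume fh: "f - h \<in> pts Y"
  have nn: "0 \<le> nrm Y (f - h)" using Y fh by (rule banach_spaceD)
  show "S f - S h \<in> pts Y" using ap[of 1] fh by (auto simp: lip_ineq_def)
  show "nrm Y (S f - S h) \<le> c * nrm Y (f - h)"
  proof (rule field_le_epsilon)
    fix e :: real assume e: "0 < e"
    define d where "d = e / (nrm Y (f - h) + 1)"
    have d: "0 < d" "d * nrm Y (f - h) \<le> e" using e nn by (auto simp: d_def field_simps)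
    obtain c' where c': "lip_ineq Y S c' f h" "c' < c + d" using ap[OF d(1)] by blast
    have "nrm Y (S f - S h) \<le> c' * nrm Y (f - h)" using c'(1) fh by (simp add: lip_ineq_def)
    also have "\<dots> \<le> (c + d) * nrm Y (f - h)" using c'(2) nn by (intro mult_right_mono) auto
    also have "\<dots> \<le> c * nrm Y (f - h) + e" using d(2) by (simp add: distrib_right)
    finally show "nrm Y (S f - S h) \<le> c * nrm Y (f - h) + e" .
  qed
qed

context compatible_couple
begin

lemma Lip_norm:
  assumes "admissible_Lipschitz X D S"
  shows "Lip_bound X D S (Lip_norm X D S)" "Lip_bound X D S C \<Longrightarrow> Lip_norm X D S \<le> C"
proof -
  obtain C0 where C0: "Lip_bound X D S C0" using assms by (auto simp: admissible_Lipschitz_def)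
  have closed: "Lip_bound X D S c"
    if c: "0 \<le> c" "\<And>e. 0 < e \<Longrightarrow> \<exists>c'. Lip_bound X D S c' \<and> c' < c + e" for c
    unfolding Lip_bound_def
  proof (intro conjI ballI)
    fix f h assume fh: "f \<in> D" "h \<in> D"
    show "lip_ineq X0 S c f h" "lip_ineq X1 S c f h"
      by (rule lip_ineq_closed; use c(2) fh banach_X0 banach_X1 in \<open>unfold Lip_bound_def, blast\<close>)+
  qed (use c in simp)
  show "Lip_bound X D S (Lip_norm X D S)" "Lip_bound X D S C \<Longrightarrow> Lip_norm X D S \<le> C"
    unfolding Lip_norm_def
    using Least_real_closed[of "Lip_bound X D S", OF C0 _ closed] by (auto simp: Lip_bound_def)
qed

text \<open>Write \<open>(f - h)\<^sup>+ = v\<^sub>0 + v\<^sub>1\<close> with \<open>v\<^sub>i \<ge> 0\<close> and go from \<open>h\<close> to \<open>f \<curlyvee> h = h + v\<^sub>0 + v\<^sub>1\<close> through \<open>h + v\<^sub>0\<close>, which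
is in the domain because the domain is solid. The increments of \<open>S\<close> along the two steps are positive
as \<open>S\<close> preserves the order, are bounded in \<open>X\<^sub>0\<close> and \<open>X\<^sub>1\<close> by the Lipschitz condition, and their sum
dominates \<open>(S f - S h)\<^sup>+\<close>.\<close>

lemma order_preserving_Lip_split:
  assumes Lip: "Lip_bound X D S C" and S: "operator_on X D S" "order_preserving X D S"
    and D: "solid_lattice X D" and fh: "f \<in> D" "h \<in> D"
    and u: "u0 \<in> pts X0" "u1 \<in> pts X1" "f - h = u0 + u1"
  shows "\<exists>p0\<in>pts X0. \<exists>p1\<in>pts X1. pos (S f - S h) = p0 + p1 \<and> 0 \<preceq> p0 \<and> 0 \<preceq> p1 \<and>
    nrm X0 p0 \<le> C * nrm X0 (pos u0) \<and> nrm X1 p1 \<le> C * nrm X1 (pos u1)"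
proof -
  have DV: "D \<subseteq> V" and SV: "\<And>x. x \<in> D \<Longrightarrow> S x \<in> V" using S(1) by (auto simp: operator_on_def)
  have V: "f \<in> V" "h \<in> V" "S f \<in> V" "S h \<in> V" using fh DV SV by auto
  have C: "0 \<le> C" using Lip by (simp add: Lip_bound_def)
  have "pos (f - h) \<preceq> pos u0 + pos u1" unfolding u(3) using u by (intro pos_add_le) auto
  then obtain v0 v1 where v: "v0 \<in> pts X0" "v1 \<in> pts X1" "pos (f - h) = v0 + v1" "0 \<preceq> v0" "0 \<preceq> v1"
      "nrm X0 v0 \<le> nrm X0 (pos u0)" "nrm X1 v1 \<le> nrm X1 (pos u1)"
    using dominated_split[of "pos (f - h)" "pos u0" "pos u1"] u V by auto
  have k: "jn f h = h + v0 + v1"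
  proof -
    have "jn (f - h + h) (0 + h) = pos (f - h) + h" using V by (intro join_add) auto
    then have "jn f h = v0 + v1 + h" unfolding v(3) by simp
    then show ?thesis by (simp only: ac_simps)
  qed
  have kD: "jn f h \<in> D" using D fh unfolding solid_lattice_def sum_ord_def by blast
  have m1: "h \<preceq> h + v0" by (rule le_if_diff_eq[OF v(4)]) (use V v in simp_all)
  have m2: "h + v0 \<preceq> jn f h" unfolding k by (rule le_if_diff_eq[OF v(5)]) (use V v in simp_all)
  have mV: "h + v0 \<in> V" using V v by simp
  have mD: "h + v0 \<in> D"
    using D fh(2) kD m1 m2 mV unfolding solid_lattice_def by blast
  have mono: "S b \<preceq> S a" if "a \<in> D" "b \<in> D" "b \<preceq> a" for a b
    using S(2) that by (simp add: order_preserving_def)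
  have inc1: "S h \<preceq> S (h + v0)" and inc2: "S (h + v0) \<preceq> S (jn f h)"
    using mono fh(2) mD kD m1 m2 by blast+
  have inc3: "S f \<preceq> S (jn f h)" using mono[OF kD fh(1)] ord.join_left[of f h] V by simp
  define b0 where "b0 = S (h + v0) - S h"
  define b1 where "b1 = S (jn f h) - S (h + v0)"
  have SmV: "S (h + v0) \<in> V" "S (jn f h) \<in> V" using SV mD kD by blast+
  then have bV: "b0 \<in> V" "b1 \<in> V" using V by (simp_all add: b0_def b1_def)
  have bp0: "0 \<preceq> b0" unfolding b0_def by (rule le_if_diff_eq[OF inc1]) (use V SmV in simp_all)
  have bp1: "0 \<preceq> b1" unfolding b1_def by (rule le_if_diff_eq[OF inc2]) (use V SmV in simp_all)
  have lip: "lip_ineq X0 S C (h + v0) h" "lip_ineq X1 S C (jn f h) (h + v0)"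
    using Lip mD kD fh(2) by (simp_all add: Lip_bound_def)
  have "h + v0 - h = v0" by simp
  then have b0: "b0 \<in> pts X0" "nrm X0 b0 \<le> C * nrm X0 v0"
    using lip(1) v(1) by (simp_all add: lip_ineq_def b0_def)
  have "jn f h - (h + v0) = v1" unfolding k by simp
  then have b1: "b1 \<in> pts X1" "nrm X1 b1 \<le> C * nrm X1 v1"
    using lip(2) v(2) by (simp_all add: lip_ineq_def b1_def)
  have "S f - S h \<preceq> b0 + b1"
    by (rule le_if_diff_eq[OF inc3]) (use V SmV bV in \<open>simp_all add: b0_def b1_def\<close>)
  then have "pos (S f - S h) \<preceq> b0 + b1"
    using V bV add_nonneg[OF bV bp0 bp1] by (intro pos_le) simp_all
  then obtain p0 p1 where p: "p0 \<in> pts X0" "p1 \<in> pts X1" "pos (S f - S h) = p0 + p1" "0 \<preceq> p0" "0 \<preceq> p1"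
      "nrm X0 p0 \<le> nrm X0 b0" "nrm X1 p1 \<le> nrm X1 b1"
    using dominated_split[of "pos (S f - S h)" b0 b1] V bp0 bp1 b0(1) b1(1) by auto
  have "C * nrm X0 v0 \<le> C * nrm X0 (pos u0)" "C * nrm X1 v1 \<le> C * nrm X1 (pos u1)"
    using v C by (simp_all add: mult_left_mono)
  then have "nrm X0 p0 \<le> C * nrm X0 (pos u0)" "nrm X1 p1 \<le> C * nrm X1 (pos u1)"
    using p b0(2) b1(2) by linarith+
  then show ?thesis using p by blast
qed

text \<open>Negative parts are handled by exchanging \<open>f\<close> and \<open>h\<close>.\<close>

lemma order_preserving_Lip_GP_pair:
  assumes Lip: "Lip_bound X D S C" and S: "operator_on X D S" "order_preserving X D S"
    and D: "solid_lattice X D" and fh: "f \<in> D" "h \<in> D"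
  shows "GP_pair C (f - h) (S f - S h)"
proof (rule GP_pairI)
  fix u0 u1 e assume u: "u0 \<in> pts X0" "u1 \<in> pts X1" "f - h = u0 + u1" "0 < (e::real)"
  have "S f \<in> V" "S h \<in> V" using S(1) fh by (auto simp: operator_on_def)
  then have V: "S f - S h \<in> V" by simp
  have "h - f = - (u0 + u1)" unfolding u(3)[symmetric] by simp
  then have u': "- u0 \<in> pts X0" "- u1 \<in> pts X1" "h - f = - u0 + - u1" using u by simp_all
  obtain p0 p1 where p: "p0 \<in> pts X0" "p1 \<in> pts X1" "pos (S f - S h) = p0 + p1" "0 \<preceq> p0" "0 \<preceq> p1"
      "nrm X0 p0 \<le> C * nrm X0 (pos u0)" "nrm X1 p1 \<le> C * nrm X1 (pos u1)"
    using order_preserving_Lip_split[OF Lip S D fh u(1-3)] by blast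
  obtain n0 n1 where n: "n0 \<in> pts X0" "n1 \<in> pts X1" "pos (S h - S f) = n0 + n1" "0 \<preceq> n0" "0 \<preceq> n1"
      "nrm X0 n0 \<le> C * nrm X0 (neg u0)" "nrm X1 n1 \<le> C * nrm X1 (neg u1)"
    using order_preserving_Lip_split[OF Lip S D fh(2,1) u'] by blast
  have n3: "neg (S f - S h) = n0 + n1" using n(3) by simp
  note s = signed_split[OF V p(3) n3 p(1,2) n(1,2) p(4,5) n(4,5)]
  have mem: "p0 - n0 \<in> pts X0" "p1 - n1 \<in> pts X1" using p n by simp_all
  have "nrm X0 (pos (p0 - n0)) \<le> C * nrm X0 (pos u0) + e" "nrm X0 (neg (p0 - n0)) \<le> C * nrm X0 (neg u0) + e"
    "nrm X1 (pos (p1 - n1)) \<le> C * nrm X1 (pos u1) + e" "nrm X1 (neg (p1 - n1)) \<le> C * nrm X1 (neg u1) + e"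
    using s(2-5) p(6,7) n(6,7) u(4) by linarith+
  then show "\<exists>g0\<in>pts X0. \<exists>g1\<in>pts X1. S f - S h = g0 + g1 \<and>
      nrm X0 (pos g0) \<le> C * nrm X0 (pos u0) + e \<and> nrm X0 (neg g0) \<le> C * nrm X0 (neg u0) + e \<and>
      nrm X1 (pos g1) \<le> C * nrm X1 (pos u1) + e \<and> nrm X1 (neg g1) \<le> C * nrm X1 (neg u1) + e"
    using mem s(1) by blast
qed

end

lemma (in intermediate) GP_imp_Lip:
  assumes "exact_interpolation_GP X Z"
  shows "exact_interpolation_Lip X Z"
  unfolding exact_interpolation_Lip_def lip_ineq_def
proof (intro allI impI ballI)
  fix D S f h
  assume "admissible_Lipschitz X D S \<and> order_preserving X D S \<and> solid_lattice X D"
  then have S: "admissible_Lipschitz X D S" "order_preserving X D S" "solid_lattice X D" by auto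
  assume fh: "f \<in> D" "h \<in> D" "f - h \<in> pts Z"
  have op: "operator_on X D S" using S by (simp add: admissible_Lipschitz_def)
  note Lip = Lip_norm(1)[OF S(1)]
  show "S f - S h \<in> pts Z \<and> nrm Z (S f - S h) \<le> Lip_norm X D S * nrm Z (f - h)"
  proof (rule exact_GP_pair[OF assms fh(3)])
    have "S f \<in> V" "S h \<in> V" using op fh by (auto simp: operator_on_def)
    then show "S f - S h \<in> V" by simp
    show "0 \<le> Lip_norm X D S" using Lip by (simp add: Lip_bound_def)
    show "GP_pair (Lip_norm X D S) (f - h) (S f - S h)"
      by (rule order_preserving_Lip_GP_pair[OF Lip op S(2,3) fh(1,2)])
  qed
qed

section \<open>Positive linear operators\<close>

lemma op_norm_le:
  assumes "f0 \<in> pts Y" "nrm Y f0 \<le> 1"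
    and "\<And>f. \<lbrakk>f \<in> pts Y; nrm Y f \<le> 1\<rbrakk> \<Longrightarrow> nrm W (S f) \<le> C"
  shows "op_norm Y W S \<le> C"
  unfolding op_norm_def using assms by (intro cSup_least) blast+

lemma bounded_op_norm:
  assumes Y: "banach_space Y" and W: "banach_space W" and S: "bounded_op Y W S"
    and hom: "\<And>f c. f \<in> pts Y \<Longrightarrow> S (c *\<^sub>R f) = c *\<^sub>R S f"
  shows "0 \<le> op_norm Y W S" "f \<in> pts Y \<Longrightarrow> nrm W (S f) \<le> op_norm Y W S * nrm Y f"
proof -
  obtain C where C: "\<And>f. f \<in> pts Y \<Longrightarrow> nrm W (S f) \<le> C * nrm Y f" using S by (auto simp: bounded_op_def)
  have mem: "S f \<in> pts W" if "f \<in> pts Y" for f using S that by (auto simp: bounded_op_def)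
  have bdd: "bdd_above {nrm W (S f) | f. f \<in> pts Y \<and> nrm Y f \<le> 1}"
  proof (intro bdd_aboveI[of _ "\<bar>C\<bar>"], clarify)
    fix f assume f: "f \<in> pts Y" "nrm Y f \<le> 1"
    have nn: "0 \<le> nrm Y f" using Y f(1) by (rule banach_spaceD)
    have "nrm W (S f) \<le> \<bar>C\<bar> * nrm Y f"
      using C[OF f(1)] mult_right_mono[OF abs_ge_self[of C] nn] by linarith
    also have "\<dots> \<le> \<bar>C\<bar> * 1" using f by (intro mult_left_mono) auto
    finally show "nrm W (S f) \<le> \<bar>C\<bar>" by simp
  qed
  have up: "nrm W (S f) \<le> op_norm Y W S" if "f \<in> pts Y" "nrm Y f \<le> 1" for f
    unfolding op_norm_def using bdd that by (intro cSup_upper) auto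
  have S0: "S 0 = 0" using hom[of 0 0] Y by (simp add: banach_spaceD)
  show "0 \<le> op_norm Y W S"
    using up[of 0] Y W S0 by (simp add: banach_spaceD)
  show "nrm W (S f) \<le> op_norm Y W S * nrm Y f" if f: "f \<in> pts Y"
  proof (cases "f = 0")
    case True then show ?thesis using Y W S0 by (simp add: banach_spaceD)
  next
    case False
    define n where "n = nrm Y f"
    have n: "0 < n" using banach_spaceD(3,4)[OF Y f] False by (auto simp: n_def less_le)
    have "nrm Y ((1/n) *\<^sub>R f) = 1" using n banach_spaceD(5)[OF Y f, of "1/n"] by (simp add: n_def)
    then have "nrm W (S ((1/n) *\<^sub>R f)) \<le> op_norm Y W S"
      using Y f by (intro up) (simp_all add: banach_spaceD)
    then have "(1/n) * nrm W (S f) \<le> op_norm Y W S"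
      using n hom[OF f, of "1/n"] banach_spaceD(5)[OF W mem[OF f], of "1/n"] by simp
    then show ?thesis using n by (simp add: field_simps n_def)
  qed
qed

context compatible_couple
begin

lemma couple_opsD:
  assumes "S \<in> couple_ops X X"
  shows "f \<in> V \<Longrightarrow> S f \<in> V"
    and "\<lbrakk>f \<in> V; g \<in> V\<rbrakk> \<Longrightarrow> S (f + g) = S f + S g"
    and "f \<in> V \<Longrightarrow> S (c *\<^sub>R f) = c *\<^sub>R S f"
    and "f \<in> pts X0 \<Longrightarrow> S f \<in> pts X0 \<and> nrm X0 (S f) \<le> couple_norm X X S * nrm X0 f"
    and "f \<in> pts X1 \<Longrightarrow> S f \<in> pts X1 \<and> nrm X1 (S f) \<le> couple_norm X X S * nrm X1 f"
    and "0 \<le> couple_norm X X S"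
proof -
  show lin: "f \<in> V \<Longrightarrow> S f \<in> V" "\<lbrakk>f \<in> V; g \<in> V\<rbrakk> \<Longrightarrow> S (f + g) = S f + S g"
      "f \<in> V \<Longrightarrow> S (c *\<^sub>R f) = c *\<^sub>R S f" for f g c
    using assms by (auto simp: couple_ops_def)
  have b: "bounded_op X0 X0 S" "bounded_op X1 X1 S" using assms by (auto simp: couple_ops_def)
  have max: "op_norm X0 X0 S \<le> couple_norm X X S" "op_norm X1 X1 S \<le> couple_norm X X S"
    by (auto simp: couple_norm_def)
  show "f \<in> pts X0 \<Longrightarrow> S f \<in> pts X0 \<and> nrm X0 (S f) \<le> couple_norm X X S * nrm X0 f"
    using bounded_op_norm(2)[OF banach_X0 banach_X0 b(1) lin(3), of f] b(1)
      mult_right_mono[OF max(1), of "nrm X0 f"] by (auto simp: bounded_op_def)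
  show "f \<in> pts X1 \<Longrightarrow> S f \<in> pts X1 \<and> nrm X1 (S f) \<le> couple_norm X X S * nrm X1 f"
    using bounded_op_norm(2)[OF banach_X1 banach_X1 b(2) lin(3), of f] b(2)
      mult_right_mono[OF max(2), of "nrm X1 f"] by (auto simp: bounded_op_def)
  show "0 \<le> couple_norm X X S"
    using bounded_op_norm(1)[OF banach_X0 banach_X0 b(1) lin(3)] max(1) by simp
qed

lemma couple_ops_uminus: assumes "S \<in> couple_ops X X" "f \<in> V" shows "S (- f) = - S f"
  using couple_opsD(3)[OF assms, of "-1"] by simp

lemma couple_ops_diff:
  assumes "S \<in> couple_ops X X" "f \<in> V" "g \<in> V" shows "S (f - g) = S f - S g"
  using couple_opsD(2)[OF assms(1,2), of "- g"] couple_ops_uminus[OF assms(1,3)] assms(3) by simp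

lemma pos_couple_opsD:
  assumes "S \<in> pos_couple_ops X X"
  shows "S \<in> couple_ops X X" "\<lbrakk>f \<in> V; 0 \<preceq> f\<rbrakk> \<Longrightarrow> 0 \<preceq> S f"
  using assms by (auto simp: pos_couple_ops_def)

end

text \<open>A positive linear operator is order preserving and Lipschitz on the whole sum space, and it maps 0 to
0, so comparing with 0 turns the Lipschitz estimate into a norm estimate.\<close>

lemma (in intermediate) Lip_imp_pos_linear:
  assumes Lip: "exact_interpolation_Lip X Z"
  shows "exact_interpolation_pos_linear X Z"
  unfolding exact_interpolation_pos_linear_def
proof
  fix S assume S: "S \<in> pos_couple_ops X X"
  note S' = pos_couple_opsD(1)[OF S]
  let ?c = "couple_norm X X S"
  have op: "operator_on X V S" using couple_opsD(1)[OF S'] by (auto simp: operator_on_def)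
  have b: "Lip_bound X V S ?c"
    unfolding Lip_bound_def lip_ineq_def
  proof (intro conjI ballI impI couple_opsD(6)[OF S'])
    fix f h assume fh: "f \<in> V" "h \<in> V"
    have *: "S f - S h = S (f - h)" using couple_ops_diff[OF S' fh] by simp
    show "S f - S h \<in> pts X0" "nrm X0 (S f - S h) \<le> ?c * nrm X0 (f - h)" if "f - h \<in> pts X0"
      unfolding * using couple_opsD(4)[OF S' that] by auto
    show "S f - S h \<in> pts X1" "nrm X1 (S f - S h) \<le> ?c * nrm X1 (f - h)" if "f - h \<in> pts X1"
      unfolding * using couple_opsD(5)[OF S' that] by auto
  qed
  then have adm: "admissible_Lipschitz X V S" using op by (auto simp: admissible_Lipschitz_def)
  have "order_preserving X V S"
    unfolding order_preserving_def
  proof (intro ballI impI)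
    fix f g assume fg: "f \<in> V" "g \<in> V" "g \<preceq> f"
    have "0 \<preceq> f - g" by (rule le_if_diff_eq[OF fg(3)]) (use fg in auto)
    then have "0 \<preceq> S (f - g)" using fg by (intro pos_couple_opsD(2)[OF S]) auto
    then show "S g \<preceq> S f"
      by (rule le_if_diff_eq) (use fg couple_ops_diff[OF S'] couple_opsD(1)[OF S'] in auto)
  qed
  moreover have "solid_lattice X V" by (auto simp: solid_lattice_def sum_ord_def)
  ultimately have *: "lip_ineq Z S (Lip_norm X V S) f h" if "f \<in> V" "h \<in> V" for f h
    using Lip adm that unfolding exact_interpolation_Lip_def by blast
  have S0: "S 0 = 0" using couple_opsD(3)[OF S', of 0 0] by simp
  have Z: "S f \<in> pts Z \<and> nrm Z (S f) \<le> ?c * nrm Z f" if f: "f \<in> pts Z" for f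
  proof -
    have "S f \<in> pts Z" "nrm Z (S f) \<le> Lip_norm X V S * nrm Z f"
      using *[of f 0] f S0 by (auto simp: lip_ineq_def)
    moreover have "Lip_norm X V S * nrm Z f \<le> ?c * nrm Z f"
      using Lip_norm(2)[OF adm b] f by (intro mult_right_mono) auto
    ultimately show ?thesis by linarith
  qed
  have "op_norm Z Z S \<le> ?c"
  proof (rule op_norm_le[of 0])
    fix f assume f: "f \<in> pts Z" "nrm Z f \<le> 1"
    have "?c * nrm Z f \<le> ?c * 1" using f couple_opsD(6)[OF S'] by (intro mult_left_mono) auto
    then show "nrm Z (S f) \<le> ?c" using Z[OF f(1)] by linarith
  qed simp_all
  moreover have "bounded_op Z Z S" using Z by (auto simp: bounded_op_def)
  ultimately show "bounded_op Z Z S \<and> op_norm Z Z S \<le> ?c" by simp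
qed

section \<open>Gluing positive contractions along band projections\<close>

context compatible_couple
begin

definition positive_contraction :: "('a \<Rightarrow> 'a) \<Rightarrow> bool" where
  "positive_contraction F \<longleftrightarrow>
     (\<forall>f\<in>V. F f \<in> V) \<and> (\<forall>f\<in>V. \<forall>g\<in>V. F (f + g) = F f + F g) \<and>
     (\<forall>f\<in>V. \<forall>c. F (c *\<^sub>R f) = c *\<^sub>R F f) \<and> (\<forall>f\<in>V. 0 \<preceq> f \<longrightarrow> 0 \<preceq> F f) \<and>
     (\<forall>f\<in>pts X0. F f \<in> pts X0 \<and> nrm X0 (F f) \<le> nrm X0 f) \<and>
     (\<forall>f\<in>pts X1. F f \<in> pts X1 \<and> nrm X1 (F f) \<le> nrm X1 f)"

lemma positive_contractionD:
  assumes "positive_contraction F"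
  shows "f \<in> V \<Longrightarrow> F f \<in> V"
    and "\<lbrakk>f \<in> V; g \<in> V\<rbrakk> \<Longrightarrow> F (f + g) = F f + F g"
    and "f \<in> V \<Longrightarrow> F (c *\<^sub>R f) = c *\<^sub>R F f"
    and "\<lbrakk>f \<in> V; 0 \<preceq> f\<rbrakk> \<Longrightarrow> 0 \<preceq> F f"
    and "f \<in> pts X0 \<Longrightarrow> F f \<in> pts X0 \<and> nrm X0 (F f) \<le> nrm X0 f"
    and "f \<in> pts X1 \<Longrightarrow> F f \<in> pts X1 \<and> nrm X1 (F f) \<le> nrm X1 f"
  using assms by (simp_all add: positive_contraction_def)

lemma positive_contraction_couple_op:
  assumes T: "T \<in> pos_couple_ops X X" "couple_norm X X T \<le> 1"
  shows "positive_contraction T"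
  unfolding positive_contraction_def
proof (intro conjI ballI impI allI)
  note T' = pos_couple_opsD(1)[OF T(1)]
  fix f
  have le: "couple_norm X X T * x \<le> x" if "0 \<le> x" for x
    using mult_right_mono[OF T(2) that] by simp
  show "T f \<in> pts X0" "nrm X0 (T f) \<le> nrm X0 f" if "f \<in> pts X0"
    using couple_opsD(4)[OF T' that] le[of "nrm X0 f"] that by auto
  show "T f \<in> pts X1" "nrm X1 (T f) \<le> nrm X1 f" if "f \<in> pts X1"
    using couple_opsD(5)[OF T' that] le[of "nrm X1 f"] that by auto
qed (simp_all add: couple_opsD(1-3)[OF pos_couple_opsD(1)[OF T(1)]] pos_couple_opsD(2)[OF T(1)])

lemma positive_contraction_comp:
  assumes F: "positive_contraction F" and G: "positive_contraction G"
  shows "positive_contraction (\<lambda>f. F (G f))"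
  unfolding positive_contraction_def
proof (intro conjI ballI impI allI)
  note D = positive_contractionD
  fix f
  show "F (G f) \<in> pts X0" "nrm X0 (F (G f)) \<le> nrm X0 f" if "f \<in> pts X0"
    using D(5)[OF G that] D(5)[OF F, of "G f"] by auto
  show "F (G f) \<in> pts X1" "nrm X1 (F (G f)) \<le> nrm X1 f" if "f \<in> pts X1"
    using D(6)[OF G that] D(6)[OF F, of "G f"] by auto
qed (simp_all add: positive_contractionD(1-4)[OF F] positive_contractionD(1-4)[OF G])

lemma mem_sum_image_couple:
  "f \<in> pts (sum_space (image_couple A X)) \<longleftrightarrow> (\<exists>f0\<in>pts X0. \<exists>f1\<in>pts X1. f = A f0 + A f1)"
  by (auto simp: sum_space_def image_couple_def)

text \<open>For \<open>A = P\<close>, \<open>R = Q\<close> and for the complementary projections this provides the two corners that the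
diagonal contraction property glues together.\<close>

lemma compression_pos_couple_op:
  assumes A: "positive_contraction A" and R: "positive_contraction R" and T: "positive_contraction T"
  shows "(\<lambda>f. R (T f)) \<in> pos_couple_ops (image_couple A X) (image_couple R X)"
    and "couple_norm (image_couple A X) (image_couple R X) (\<lambda>f. R (T f)) \<le> 1"
proof -
  note D = positive_contractionD
  have RT: "positive_contraction (\<lambda>f. R (T f))" by (rule positive_contraction_comp[OF R T])
  let ?A = "image_couple A X" and ?R = "image_couple R X" and ?S = "\<lambda>f. R (T f)"
  have mem0: "\<And>f. f \<in> pts X0 \<Longrightarrow> A f \<in> pts X0 \<and> T (A f) \<in> pts X0"
    and mem1: "\<And>f. f \<in> pts X1 \<Longrightarrow> A f \<in> pts X1 \<and> T (A f) \<in> pts X1"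
    using D(5)[OF A] D(6)[OF A] D(5)[OF T] D(6)[OF T] by blast+
  have sub: "f \<in> V" if "f \<in> pts (sum_space ?A)" for f
    using that mem0 mem1 by (auto simp: mem_sum_image_couple)
  have maps: "?S f \<in> pts (sum_space ?R)" if f: "f \<in> pts (sum_space ?A)" for f
  proof -
    obtain f0 f1 where f: "f0 \<in> pts X0" "f1 \<in> pts X1" "f = A f0 + A f1"
      using f by (auto simp: mem_sum_image_couple)
    then have "?S f = R (T (A f0)) + R (T (A f1))"
      using D(2)[OF RT, of "A f0" "A f1"] mem0[of f0] mem1[of f1] by simp
    then show ?thesis using f mem0[of f0] mem1[of f1] unfolding mem_sum_image_couple by blast
  qed
  have b: "nrm X0 (?S f) \<le> 1 * nrm X0 f" if "f \<in> A ` pts X0" for f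
    using that mem0 D(5)[OF RT] by auto
  moreover note b
  moreover have c: "nrm X1 (?S f) \<le> 1 * nrm X1 f" if "f \<in> A ` pts X1" for f
    using that mem1 D(6)[OF RT] by auto
  moreover have "?S ` (A ` pts X0) \<subseteq> R ` pts X0" "?S ` (A ` pts X1) \<subseteq> R ` pts X1"
    using mem0 mem1 by blast+
  ultimately have "bounded_op (sp0 ?A) (sp0 ?R) ?S" "bounded_op (sp1 ?A) (sp1 ?R) ?S"
    unfolding bounded_op_def by (auto simp: image_couple_def intro!: exI[of _ 1])
  moreover have "?S ` pts (sum_space ?A) \<subseteq> pts (sum_space ?R)" using maps by blast
  moreover have "leq ?A = leq X" "leq ?R = leq X" by (simp_all add: image_couple_def)
  ultimately show "?S \<in> pos_couple_ops ?A ?R"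
    using sub D(2,3,4)[OF RT] by (simp add: pos_couple_ops_def couple_ops_def)
  have A0: "A 0 = 0" using D(3)[OF A, of 0 0] by simp
  have "0 \<in> A ` pts X0" "0 \<in> A ` pts X1"
    using imageI[of 0 "pts X0" A] imageI[of 0 "pts X1" A] A0 by simp_all
  then have z: "0 \<in> pts (sp0 ?A)" "0 \<in> pts (sp1 ?A)" by (simp_all add: image_couple_def)
  have "op_norm (sp0 ?A) (sp0 ?R) ?S \<le> 1"
    by (rule op_norm_le[OF z(1)]) (use b in \<open>force simp: image_couple_def\<close>)+
  moreover have "op_norm (sp1 ?A) (sp1 ?R) ?S \<le> 1"
    by (rule op_norm_le[OF z(2)]) (use c in \<open>force simp: image_couple_def\<close>)+
  ultimately show "couple_norm ?A ?R ?S \<le> 1" by (simp add: couple_norm_def)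
qed

lemma positive_contraction_pos_couple_op:
  assumes "positive_contraction F" shows "F \<in> pos_couple_ops X X"
  using positive_contractionD[OF assms]
  by (auto simp: pos_couple_ops_def couple_ops_def bounded_op_def intro!: exI[of _ 1])

lemma positive_contraction_of_md_le:
  assumes "\<And>f. f \<in> V \<Longrightarrow> F f \<in> V" "\<And>f g. \<lbrakk>f \<in> V; g \<in> V\<rbrakk> \<Longrightarrow> F (f + g) = F f + F g"
    "\<And>f c. f \<in> V \<Longrightarrow> F (c *\<^sub>R f) = c *\<^sub>R F f" "\<And>f. \<lbrakk>f \<in> V; 0 \<preceq> f\<rbrakk> \<Longrightarrow> 0 \<preceq> F f"
    "\<And>f. f \<in> V \<Longrightarrow> md (F f) \<preceq> md f"
  shows "positive_contraction F"
  unfolding positive_contraction_def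
proof (intro conjI ballI impI allI)
  fix f
  show "F f \<in> pts X0" "nrm X0 (F f) \<le> nrm X0 f" if "f \<in> pts X0"
    using ideal_space_norm[OF ideal_space_X0 assms(1) that assms(5)] that by auto
  show "F f \<in> pts X1" "nrm X1 (F f) \<le> nrm X1 f" if "f \<in> pts X1"
    using ideal_space_norm[OF ideal_space_X1 assms(1) that assms(5)] that by auto
qed (use assms(1-4) in blast)+

lemma band_projection_positive_contraction:
  assumes "riesz_band_projection V le_X B P"
  shows "positive_contraction P" "positive_contraction (compl_op P)"
proof -
  interpret P: riesz_band_projection V le_X B P by (rule assms)
  show "positive_contraction P"
    by (rule positive_contraction_of_md_le)
      (simp_all add: P.proj_add P.proj_scaleR P.proj_nonneg P.md_proj_le)
  show "positive_contraction (compl_op P)"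
    unfolding compl_op_def[abs_def]
    by (rule positive_contraction_of_md_le)
      (simp_all add: P.proj_add P.proj_scaleR P.compl_nonneg P.md_compl_le scaleR_diff_right)
qed

text \<open>The band generated by \<open>f\<^sup>+\<close> separates the signs of \<open>f\<close>: it contains \<open>f\<^sup>+\<close> and is disjoint from \<open>f\<^sup>-\<close>.\<close>

lemma principal_band_projection_of_pos_part:
  assumes sigma: "sigma_dedekind_complete le_X X0" "sigma_dedekind_complete le_X X1"
    and f: "f \<in> V"
  obtains P where "principal_band_projection X P" "positive_contraction P"
    "positive_contraction (compl_op P)" "P (pos f) = pos f" "P (neg f) = 0"
proof -
  have u: "pos f \<in> V" "0 \<preceq> pos f" using f by simp_all
  let ?B = "principal_band L (pos f)"
  have "\<exists>s. is_supremum (range (\<lambda>n. mt x (real n *\<^sub>R pos f))) s" if x: "x \<in> V" "0 \<preceq> x" for x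
  proof -
    obtain c0 c1 where c: "c0 \<in> pts X0" "c1 \<in> pts X1" "x = c0 + c1" "0 \<preceq> c0" "0 \<preceq> c1"
      using nonneg_split_exists[OF x] by blast
    have nu: "real n *\<^sub>R pos f \<in> V" "0 \<preceq> real n *\<^sub>R pos f" for n
      using scaleR_nonneg[OF u(1) _ u(2), of "real n"] u(1) by auto
    show ?thesis
    proof (rule sum_sigma_dedekind_sup[OF ideal_space_X0 sigma(1) ideal_space_X1 sigma(2) _ _ _ c(1,2,4,5)])
      fix m n :: nat
      show "mt x (real n *\<^sub>R pos f) \<in> V" using x nu[of n] by simp
      show "0 \<preceq> mt x (real n *\<^sub>R pos f)" using x nu[of n] by (simp add: le_meet_iff)
      show "mt x (real n *\<^sub>R pos f) \<preceq> c0 + c1"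
        unfolding c(3)[symmetric] using x nu[of n] by (simp add: ord.meet_left)
      assume "m \<le> n"
      then have "0 \<preceq> (real n - real m) *\<^sub>R pos f" using u by (intro scaleR_nonneg) auto
      then have "real m *\<^sub>R pos f \<preceq> real n *\<^sub>R pos f"
        by (rule le_if_diff_eq) (use nu u in \<open>simp_all add: scaleR_diff_left\<close>)
      then show "mt x (real m *\<^sub>R pos f) \<preceq> mt x (real n *\<^sub>R pos f)"
        using x nu by (intro meet_mono) simp_all
    qed
  qed
  then obtain P where P: "band_projection L ?B P"
    using principal_band_projection_exists[OF u] by blast
  have "band L ?B" by (rule band_principal_band[OF u(1)])
  then have ideal: "order_ideal L ?B" by (simp add: band_def)
  interpret P: riesz_band_projection V le_X ?B P
    using ideal P by unfold_locales
  have D: "Real_Vector_Spaces.subspace (disjoint_complement L ?B)"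
    using P.ideal_compl by (simp add: order_ideal_iff)
  have B0: "Real_Vector_Spaces.subspace ?B" using ideal by (simp add: order_ideal_iff)
  have "neg f \<in> disjoint_complement L ?B"
    using f by (intro disjoint_complement_principal_band) (simp_all add: md_of_nonneg pos_meet_neg)
  then have "P (neg f) = 0"
    using f subspace_0[OF B0] by (intro P.proj_eqI) simp_all
  moreover have "P (pos f) = pos f"
    using u subspace_0[OF D] generator_mem_principal_band by (intro P.proj_eqI) simp_all
  moreover have "principal_band_projection X P"
    using P u(1) by (auto simp: principal_band_projection_def sum_ord_def)
  moreover note band_projection_positive_contraction[OF P.riesz_band_projection_axioms]
  ultimately show ?thesis using that by blast
qed

text \<open>The couple property yields contractions \<open>T\<^sub>1\<close>, \<open>T\<^sub>2\<close> with \<open>T\<^sub>1 f\<^sup>+ = g\<^sup>+\<close> and \<open>T\<^sub>2 f\<^sup>- = g\<^sup>-\<close>. Let \<open>P\<close> and \<open>Q\<close> be the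
projections onto the bands of \<open>f\<^sup>+\<close> and \<open>g\<^sup>+\<close>. The diagonal operator built from \<open>T\<^sub>1\<close> and \<open>T\<^sub>2\<close> applies \<open>T\<^sub>1\<close>
to \<open>P f = f\<^sup>+\<close> and \<open>T\<^sub>2\<close> to \<open>f - P f = -f\<^sup>-\<close>, so it maps \<open>f\<close> to \<open>g\<^sup>+ - g\<^sup>- = g\<close>.\<close>

lemma K_dominated_positive_contraction:
  assumes CM: "exact_positive_CM_couple X"
    and sigma: "sigma_dedekind_complete le_X X0" "sigma_dedekind_complete le_X X1"
    and diag: "diagonal_contraction_property X"
    and f: "f \<in> V" and g: "g \<in> V" and K: "K_dominated X g f"
  shows "\<exists>T\<in>pos_couple_ops X X. couple_norm X X T \<le> 1 \<and> T f = g"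
proof -
  have CM': "\<exists>T. positive_contraction T \<and> T a = b"
    if "a \<in> V" "b \<in> V" "0 \<preceq> a" "0 \<preceq> b" "\<And>t. 0 < t \<Longrightarrow> Kfun X b t \<le> Kfun X a t" for a b
    using CM that positive_contraction_couple_op unfolding exact_positive_CM_couple_def by blast
  obtain T1 where T1: "positive_contraction T1" "T1 (pos f) = pos g"
    using CM'[of "pos f" "pos g"] f g K by (auto simp: K_dominated_def pos_part_eq)
  obtain T2 where T2: "positive_contraction T2" "T2 (neg f) = neg g"
    using CM'[of "neg f" "neg g"] f g K by (auto simp: K_dominated_def neg_part_eq)
  obtain P where P: "principal_band_projection X P" "positive_contraction P"
      "positive_contraction (compl_op P)" "P (pos f) = pos f" "P (neg f) = 0"
    using principal_band_projection_of_pos_part[OF sigma f] by blast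
  obtain Q where Q: "principal_band_projection X Q" "positive_contraction Q"
      "positive_contraction (compl_op Q)" "Q (pos g) = pos g" "Q (neg g) = 0"
    using principal_band_projection_of_pos_part[OF sigma g] by blast
  let ?T1 = "\<lambda>f. Q (T1 f)" and ?T2 = "\<lambda>f. compl_op Q (T2 f)"
  let ?T = "\<lambda>f. Q (?T1 (P f)) + compl_op Q (?T2 (compl_op P f))"
  have T: "?T \<in> couple_ops X X" "couple_norm X X ?T \<le> 1"
    using diag[unfolded diagonal_contraction_property_def, rule_format,
        OF positive_contraction_pos_couple_op[OF P(2)] positive_contraction_pos_couple_op[OF Q(2)] conjI[OF P(1) Q(1)]
          compression_pos_couple_op(1)[OF P(2) Q(2) T1(1)] compression_pos_couple_op(1)[OF P(3) Q(3) T2(1)]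
          conjI[OF compression_pos_couple_op(2)[OF P(2) Q(2) T1(1)] compression_pos_couple_op(2)[OF P(3) Q(3) T2(1)]]]
    by (simp_all add: Let_def)
  note D = positive_contractionD
  have "0 \<preceq> ?T x" if x: "x \<in> V" "0 \<preceq> x" for x
    using x by (intro add_nonneg D(1,4)[OF Q(2)] D(1,4)[OF Q(3)] D(1,4)[OF T1(1)] D(1,4)[OF T2(1)]
        D(1,4)[OF P(2)] D(1,4)[OF P(3)])
  then have "?T \<in> pos_couple_ops X X" using T(1) by (simp add: pos_couple_ops_def)
  moreover have "?T f = g"
  proof -
    have F: "F (h - k) = F h - F k" "F (- k) = - F k" if "positive_contraction F" "h \<in> V" "k \<in> V" for F h k
    proof -
      show m: "F (- k) = - F k" using D(3)[OF that(1,3), of "-1"] by simp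
      show "F (h - k) = F h - F k" using D(2)[OF that(1,2), of "- k"] that(3) m by simp
    qed
    have V: "pos f \<in> V" "neg f \<in> V" "pos g \<in> V" "neg g \<in> V" using f g by simp_all
    have "P f = P (pos f - neg f)" using pos_minus_neg[OF f] by simp
    also have "\<dots> = pos f" using F(1)[OF P(2) V(1,2)] P(4,5) by simp
    finally have Pf: "P f = pos f" .
    then have Pf': "compl_op P f = - neg f"
      using pos_minus_neg[OF f] unfolding compl_op_def by (simp add: algebra_simps)
    have Qn: "compl_op Q (- neg g) = - neg g"
      using F(2)[OF Q(2) V(4) V(4)] Q(5) by (simp add: compl_op_def)
    have "T2 (- neg f) = - neg g" using F(2)[OF T2(1) V(2) V(2)] T2(2) by simp
    then have "?T f = pos g - neg g" unfolding Pf Pf' by (simp add: T1(2) Q(4) Qn)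
    then show "?T f = g" using pos_minus_neg[OF g] by simp
  qed
  ultimately show ?thesis using T(2) by blast
qed

end

lemma (in intermediate) pos_linear_imp_K_monotone:
  assumes "exact_positive_CM_couple X"
    and "sigma_dedekind_complete (leq X) (sp0 X)" "sigma_dedekind_complete (leq X) (sp1 X)"
    and "diagonal_contraction_property X"
    and lin: "exact_interpolation_pos_linear X Z"
  shows "exact_partially_K_monotone X Z"
  unfolding exact_partially_K_monotone_def
proof (intro ballI impI)
  fix f g assume f: "f \<in> pts Z" and g: "g \<in> V" and K: "K_dominated X g f"
  obtain T where T: "T \<in> pos_couple_ops X X" "couple_norm X X T \<le> 1" "T f = g"
    using K_dominated_positive_contraction[OF assms(1-4) Z_mem[OF f] g K] by blast
  have b: "bounded_op Z Z T" "op_norm Z Z T \<le> 1"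
    using lin T(1,2) unfolding exact_interpolation_pos_linear_def by force+
  have "nrm Z (T f) \<le> op_norm Z Z T * nrm Z f"
    by (rule bounded_op_norm(2)[OF banach_Z banach_Z b(1) _ f])
      (simp add: couple_opsD(3)[OF pos_couple_opsD(1)[OF T(1)]])
  also have "\<dots> \<le> 1 * nrm Z f" using b(2) f by (intro mult_right_mono) auto
  finally show "g \<in> pts Z \<and> nrm Z g \<le> nrm Z f"
    using b(1) f T(3) by (auto simp: bounded_op_def)
qed

section \<open>Equivalence of the interpolation properties\<close>

theorem theorem4p8:
  fixes X :: "'a::hausdorff_tvs couple" and Z :: "'a nspace"
  assumes "compatible_banach_lattices X"
    and "intermediate_space X Z"
  shows "(exact_partially_K_monotone X Z \<longleftrightarrow> exact_interpolation_GP X Z) \<and>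
         (exact_interpolation_GP X Z \<longrightarrow> exact_interpolation_Lip X Z) \<and>
         (exact_interpolation_Lip X Z \<longrightarrow> exact_interpolation_pos_linear X Z) \<and>
         (exact_positive_CM_couple X \<and>
          sigma_dedekind_complete (leq X) (sp0 X) \<and> sigma_dedekind_complete (leq X) (sp1 X) \<and>
          diagonal_contraction_property X \<longrightarrow>
            (exact_partially_K_monotone X Z \<longleftrightarrow> exact_interpolation_GP X Z) \<and>
            (exact_interpolation_GP X Z \<longleftrightarrow> exact_interpolation_Lip X Z) \<and>
            (exact_interpolation_Lip X Z \<longleftrightarrow> exact_interpolation_pos_linear X Z))"
proof -
  interpret intermediate X Z
    using assms by unfold_locales
  show ?thesis
    using K_monotone_imp_GP GP_imp_K_monotone GP_imp_Lip Lip_imp_pos_linear pos_linear_imp_K_monotone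
    by blast
qed

end
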